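(* Let $X$ be a finite connected chordal bipartite $T_2$-free graph and let $\alpha$ be a vertex of $X$. Then the coherent configuration $\mathrm{WL}(X_\alpha)$ of the graph $X$ with distinguished vertex $\alpha$ is separable.
   Context: Graphs are finite, simple and undirected; a graph is a pair $X=(\Omega,D)$ with vertex set $\Omega$ and arc set $D\subseteq\Omega\times\Omega$ an irreflexive symmetric relation. A graph is chordal bipartite if it is bipartite and contains no induced cycle of length at least $6$. The bipartite claw $T_2$ is the tree on $7$ vertices obtained from the star $K_{1,3}$ by subdividing each edge exactly once. A graph is $T_2$-free if it has no induced subgraph isomorphic to $T_2$. A coherent configuration on a finite set $\Omega$ is a pair $\mathcal{X}=(\Omega,S)$, where $S$ is a partition of $\Omega^2$ such that (C1) the diagonal $\{(\omega,\omega):\omega\in\Omega\}$ is a union of some relations of $S$; (C2) for each $s\in S$ the relation $s^*=\{(\alpha,\beta):(\beta,\alpha)\in s\}$ belongs to $S$; (C3) for all $r,s,t\in S$ the number $c_{rs}^t=|\alpha r\cap\beta s^*|$ does not depend on the choice of $(\alpha,\beta)\in t$, where $\alpha r=\{\gamma\in\Omega:(\alpha,\gamma)\in r\}$. The elements of $S$ are called basis relations. For coherent configurations $\mathcal{X},\mathcal{X}'$ on the same set, $\mathcal{X}\le\mathcal{X}'$ means that each basis relation of $\mathcal{X}$ is a union of basis relations of $\mathcal{X}'$. For a set $T$ of binary relations on $\Omega$, the coherent closure $\mathrm{WL}(T)$ is the smallest (with respect to $\le$) coherent configuration on $\Omega$ for which each relation of $T$ is a union of basis relations. For a graph $X=(\Omega,D)$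 and a vertex $\alpha$, $\mathrm{WL}(X_\alpha)=\mathrm{WL}(\{D,\{(\alpha,\alpha)\}\})$. Let $\mathcal{X}=(\Omega,S)$ and $\mathcal{X}'=(\Omega',S')$ be coherent configurations. An algebraic isomorphism from $\mathcal{X}$ to $\mathcal{X}'$ is a bijection $\varphi:S\to S'$ such that $c_{rs}^t=c_{r^\varphi s^\varphi}^{t^\varphi}$ for all $r,s,t\in S$. A combinatorial isomorphism is a bijection $f:\Omega\to\Omega'$ such that $s^f=\{(\alpha^f,\beta^f):(\alpha,\beta)\in s\}\in S'$ for every $s\in S$; it induces the algebraic isomorphism $s\mapsto s^f$. A coherent configuration is separable if every algebraic isomorphism from it to another coherent configuration is induced by a combinatorial isomorphism. *)

theory Defs
  imports
    "Graph_Theory.Digraph_Isomorphism"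
    "Graph_Theory.Pair_Digraph"
    "HOL-Library.Disjoint_Sets"
begin

section \<open>Graphs\<close>

text \<open>A graph \<open>(\<Omega>, D)\<close> is an \<^typ>\<open>'a pair_pre_digraph\<close> satisfying \<^const>\<open>pair_graph\<close>: finite,
  with \<open>D \<subseteq> \<Omega> \<times> \<Omega>\<close> symmetric and irreflexive.\<close>

definition contains_induced :: "'a pair_pre_digraph \<Rightarrow> 'b pair_pre_digraph \<Rightarrow> bool" where
  "contains_induced X H \<longleftrightarrow>
     (\<exists>Y. induced_subgraph Y (with_proj X) \<and> digraph_iso (with_proj H) Y)"

definition bipartite :: "'a pair_pre_digraph \<Rightarrow> bool" where
  "bipartite X \<longleftrightarrow>
     (\<exists>U V. pverts X = U \<union> V \<and> U \<inter> V = {} \<and> parcs X \<subseteq> U \<times> V \<union> V \<times> U)"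

definition cycle_graph :: "nat \<Rightarrow> nat pair_pre_digraph" where
  "cycle_graph n =
     \<lparr> pverts = {..<n},
       parcs = {(i, j). i < n \<and> j < n \<and> (j = Suc i mod n \<or> i = Suc j mod n)} \<rparr>"

definition chordal_bipartite :: "'a pair_pre_digraph \<Rightarrow> bool" where
  "chordal_bipartite X \<longleftrightarrow>
     bipartite X \<and> (\<forall>n\<ge>6. \<not> contains_induced X (cycle_graph n))"

definition claw :: "nat pair_pre_digraph" where
  "claw = \<lparr> pverts = {0, 1, 2, 3}, parcs = {0} \<times> {1, 2, 3} \<union> {1, 2, 3} \<times> {0} \<rparr>"

definition bipartite_claw :: "nat pair_pre_digraph" where
  "bipartite_claw = subdivide (subdivide (subdivide claw (0, 1) 4) (0, 2) 5) (0, 3) 6"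

definition T2_free :: "'a pair_pre_digraph \<Rightarrow> bool" where
  "T2_free X \<longleftrightarrow> \<not> contains_induced X bipartite_claw"

lemma bipartite_claw_simps:
  "pverts bipartite_claw = {0, 1, 2, 3, 4, 5, 6}"
  "parcs bipartite_claw =
     {(0, 4), (4, 0), (0, 5), (5, 0), (0, 6), (6, 0),
      (4, 1), (1, 4), (5, 2), (2, 5), (6, 3), (3, 6)}"
  by (auto simp: bipartite_claw_def claw_def subdivide.simps)

lemma pair_graph_bipartite_claw: "pair_graph bipartite_claw"
  by unfold_locales
    (auto simp: bipartite_claw_simps symmetric_def intro!: symI)

lemma pair_graph_cycle_graph:
  assumes "n \<ge> 2"
  shows "pair_graph (cycle_graph n)"
proof -
  have "finite (parcs (cycle_graph n))"
    by (rule finite_subset[of _ "{..<n} \<times> {..<n}"]) (auto simp: cycle_graph_def)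
  moreover have "Suc j mod n \<noteq> j" if "j < n" for j
    using assms that by (cases "Suc j = n") auto
  ultimately show ?thesis
    by unfold_locales
      (force simp: cycle_graph_def symmetric_def intro!: symI)+
qed

lemma contains_induced_iff:
  assumes "pair_graph X" "pair_graph H"
  shows "contains_induced X H \<longleftrightarrow>
    (\<exists>f. inj_on f (pverts H) \<and> f ` pverts H \<subseteq> pverts X \<and>
      (\<forall>u\<in>pverts H. \<forall>v\<in>pverts H. (f u, f v) \<in> parcs X \<longleftrightarrow> (u, v) \<in> parcs H))"
    (is "?L \<longleftrightarrow> ?R")
proof
  interpret X: pair_graph X by fact
  interpret H: pair_graph H by fact
  assume ?L
  then obtain Y h where Y: "induced_subgraph Y (with_proj X)"
    and h: "pre_digraph.digraph_isomorphism (with_proj H) h" and Yh: "Y = app_iso h (with_proj H)"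
    unfolding contains_induced_def digraph_iso_def by blast
  define f where "f = iso_verts h"
  have th: "tail Y = fst" "head Y = snd"
    using Y by (auto simp: induced_subgraph_def subgraph_def compatible_def)
  have arcs_f: "iso_arcs h a = (f (fst a), f (snd a))" if "a \<in> parcs H" for a
    using h that th unfolding pre_digraph.digraph_isomorphism_def Yh f_def
    by (auto simp: prod_eq_iff)
  have inj: "inj_on f (pverts H)"
    using h by (simp add: pre_digraph.digraph_isomorphism_def f_def)
  have vY: "verts Y = f ` pverts H" by (simp add: Yh f_def)
  have aY: "arcs Y = (\<lambda>a. (f (fst a), f (snd a))) ` parcs H"
    using arcs_f by (auto simp: Yh image_def)
  have aY': "arcs Y = {e \<in> parcs X. fst e \<in> verts Y \<and> snd e \<in> verts Y}"
    using Y by (auto simp: induced_subgraph_def)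
  have "(f u, f v) \<in> parcs X \<longleftrightarrow> (u, v) \<in> parcs H" if "u \<in> pverts H" "v \<in> pverts H" for u v
  proof -
    have "(f u, f v) \<in> parcs X \<longleftrightarrow> (f u, f v) \<in> arcs Y"
      using that by (auto simp: aY' vY)
    also have "\<dots> \<longleftrightarrow> (u, v) \<in> parcs H"
      using that inj H.in_arcsD1 H.in_arcsD2 by (force simp: aY inj_on_eq_iff)
    finally show ?thesis .
  qed
  moreover have "f ` pverts H \<subseteq> pverts X"
    using Y by (auto simp: induced_subgraph_def subgraph_def vY[symmetric])
  ultimately show ?R using inj by blast
next
  interpret X: pair_graph X by fact
  interpret H: pair_graph H by fact
  assume ?R
  then obtain f where inj: "inj_on f (pverts H)" and sub: "f ` pverts H \<subseteq> pverts X"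
    and adj: "\<And>u v. u \<in> pverts H \<Longrightarrow> v \<in> pverts H \<Longrightarrow> (f u, f v) \<in> parcs X \<longleftrightarrow> (u, v) \<in> parcs H"
    by blast
  define h where "h = \<lparr> iso_verts = f, iso_arcs = map_prod f f, iso_head = snd, iso_tail = fst \<rparr>"
  have hv: "parcs H \<subseteq> pverts H \<times> pverts H"
    using H.in_arcsD1 H.in_arcsD2 by auto
  have "inj_on (map_prod f f) (parcs H)"
    using map_prod_inj_on[OF inj inj] hv by (rule inj_on_subset)
  then have "pre_digraph.digraph_isomorphism (with_proj H) h"
    using inj H.wf_digraph_axioms
    by (simp add: pre_digraph.digraph_isomorphism_def h_def)
  moreover have "induced_subgraph (app_iso h (with_proj H)) (with_proj X)"
  proof -
    have "map_prod f f ` parcs H = {e \<in> parcs X. fst e \<in> f ` pverts H \<and> snd e \<in> f ` pverts H}"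
      using adj hv by (force simp: image_iff)
    moreover have "wf_digraph (app_iso h (with_proj H))"
      using hv by unfold_locales (auto simp: h_def)
    ultimately show ?thesis
      using sub X.wf_digraph_axioms
      by (auto simp: induced_subgraph_def subgraph_def compatible_def h_def)
  qed
  ultimately show ?L
    unfolding contains_induced_def digraph_iso_def by blast
qed


section \<open>Coherent configurations\<close>

definition union_of :: "'a set set \<Rightarrow> 'a set \<Rightarrow> bool" where
  "union_of S r \<longleftrightarrow> (\<exists>U\<subseteq>S. r = \<Union>U)"

text \<open>In (C3), \<open>\<alpha> r\<close> is \<open>r `` {\<alpha>}\<close> and \<open>\<beta> s\<^sup>*\<close> is \<open>s\<inverse> `` {\<beta>}\<close>.\<close>

locale coherent_configuration =
  fixes \<Omega> :: "'a set" and S :: "'a rel set"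
  assumes finite_points: "finite \<Omega>"
    and partition: "partition_on (\<Omega> \<times> \<Omega>) S"
    and diagonal: "union_of S (Id_on \<Omega>)"
    and converse_closed: "s \<in> S \<Longrightarrow> s\<inverse> \<in> S"
    and intersection_constant:
      "\<lbrakk> r \<in> S; s \<in> S; t \<in> S \<rbrakk> \<Longrightarrow>
         \<exists>c. \<forall>(\<alpha>, \<beta>)\<in>t. card (r `` {\<alpha>} \<inter> s\<inverse> `` {\<beta>}) = c"

text \<open>The number \<open>c\<^sub>r\<^sub>s\<^sup>t\<close>; meaningful only for basis relations \<open>r\<close>, \<open>s\<close>, \<open>t\<close> of a coherent
  configuration, where existence is (C3) and uniqueness follows from \<open>t \<noteq> {}\<close>.\<close>

definition intersection_number :: "'a rel \<Rightarrow> 'a rel \<Rightarrow> 'a rel \<Rightarrow> nat" where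
  "intersection_number r s t =
     (THE c. \<forall>(\<alpha>, \<beta>)\<in>t. card (r `` {\<alpha>} \<inter> s\<inverse> `` {\<beta>}) = c)"

text \<open>The order \<open>\<le>\<close> on coherent configurations on the same set.\<close>

definition conf_le :: "'a rel set \<Rightarrow> 'a rel set \<Rightarrow> bool" where
  "conf_le S S' \<longleftrightarrow> (\<forall>s\<in>S. union_of S' s)"

definition is_coherent_closure :: "'a set \<Rightarrow> 'a rel set \<Rightarrow> 'a rel set \<Rightarrow> bool" where
  "is_coherent_closure \<Omega> T S \<longleftrightarrow>
     coherent_configuration \<Omega> S \<and> (\<forall>r\<in>T. union_of S r) \<and>
     (\<forall>S'. coherent_configuration \<Omega> S' \<and> (\<forall>r\<in>T. union_of S' r) \<longrightarrow> conf_le S S')"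

definition WL :: "'a set \<Rightarrow> 'a rel set \<Rightarrow> 'a rel set" where
  "WL \<Omega> T = (THE S. is_coherent_closure \<Omega> T S)"

definition WL_point :: "'a pair_pre_digraph \<Rightarrow> 'a \<Rightarrow> 'a rel set" where
  "WL_point X \<alpha> = WL (pverts X) {parcs X, {(\<alpha>, \<alpha>)}}"

text \<open>The coherent closure exists and is unique. Its basis relations are the classes of the
  equivalence relation generated by lying in a common basis relation of some coherent configuration
  that has all members of \<open>T\<close> as unions of basis relations.\<close>

lemma union_of_partition_iff:
  assumes "partition_on A S"
  shows "union_of S r \<longleftrightarrow> r \<subseteq> A \<and> (\<forall>s\<in>S. \<forall>p\<in>s. \<forall>q\<in>s. p \<in> r \<longrightarrow> q \<in> r)"
    (is "?L \<longleftrightarrow> ?R")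
proof
  assume ?L
  then obtain U where U: "U \<subseteq> S" "r = \<Union>U" by (auto simp: union_of_def)
  have "r \<subseteq> A" using U assms by (auto simp: partition_on_def)
  moreover have "q \<in> r" if pq: "s \<in> S" "p \<in> s" "q \<in> s" "p \<in> r" for s p q
  proof -
    obtain u where "u \<in> U" "p \<in> u" using U pq by blast
    moreover have "u = s"
      using \<open>u \<in> U\<close> \<open>p \<in> u\<close> that U partition_onD2[OF assms] by (auto simp: disjoint_def)
    ultimately show ?thesis using U that by blast
  qed
  ultimately show ?R by blast
next
  assume R: ?R
  have "r = \<Union>{s\<in>S. s \<subseteq> r}"
  proof
    show "r \<subseteq> \<Union>{s\<in>S. s \<subseteq> r}"
    proof
      fix p assume p: "p \<in> r"
      then have "p \<in> \<Union>S" using R partition_onD1[OF assms] by blast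
      then obtain s where s: "s \<in> S" "p \<in> s" by blast
      then have "s \<subseteq> r" using R p by blast
      then show "p \<in> \<Union>{s\<in>S. s \<subseteq> r}" using s by blast
    qed
  qed blast
  then show ?L unfolding union_of_def by (intro exI[of _ "{s\<in>S. s \<subseteq> r}"]) auto
qed

lemma coherent_configuration_discrete:
  assumes "finite \<Omega>"
  shows "coherent_configuration \<Omega> ((\<lambda>p. {p}) ` (\<Omega> \<times> \<Omega>))"
proof
  show "finite \<Omega>" by fact
  show p: "partition_on (\<Omega> \<times> \<Omega>) ((\<lambda>p. {p}) ` (\<Omega> \<times> \<Omega>))"
    by (auto simp: partition_on_def disjoint_def)
  show "union_of ((\<lambda>p. {p}) ` (\<Omega> \<times> \<Omega>)) (Id_on \<Omega>)"
    unfolding union_of_partition_iff[OF p] by auto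
qed (auto simp: image_iff)

lemma (in coherent_configuration) card_union_constant:
  assumes "union_of S r" "union_of S s" "t \<in> S" "(\<alpha>, \<beta>) \<in> t" "(\<alpha>', \<beta>') \<in> t"
  shows "card (r `` {\<alpha>} \<inter> s\<inverse> `` {\<beta>}) = card (r `` {\<alpha>'} \<inter> s\<inverse> `` {\<beta>'})"
proof -
  obtain U V where UV: "U \<subseteq> S" "r = \<Union>U" "V \<subseteq> S" "s = \<Union>V"
    using assms(1,2) by (auto simp: union_of_def)
  have sub: "x \<subseteq> \<Omega> \<times> \<Omega>" if "x \<in> S" for x
    using partition_onD1[OF partition] that by blast
  have "finite S" using finite_elements[OF _ partition] finite_points by simp
  then have fin: "finite (U \<times> V)" using UV by (auto intro: finite_subset)
  have disj: "x = y" if "x \<in> S" "y \<in> S" "p \<in> x" "p \<in> y" for x y p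
    using partition_onD2[OF partition] that by (auto simp: disjoint_def)
  let ?I = "\<lambda>a b (x, y). x `` {a} \<inter> y\<inverse> `` {b}"
  have eq: "card (r `` {a} \<inter> s\<inverse> `` {b}) = (\<Sum>z\<in>U \<times> V. card (?I a b z))" for a b
  proof -
    have "r `` {a} \<inter> s\<inverse> `` {b} = (\<Union>z\<in>U \<times> V. ?I a b z)" using UV by auto
    also have "card \<dots> = (\<Sum>z\<in>U \<times> V. card (?I a b z))"
    proof (rule card_UN_disjoint[OF fin])
      have "?I a b z \<subseteq> \<Omega>" if "z \<in> U \<times> V" for z
        using that sub UV by fastforce
      then show "\<forall>z\<in>U \<times> V. finite (?I a b z)"
        using finite_points finite_subset by blast
      show "\<forall>z\<in>U \<times> V. \<forall>w\<in>U \<times> V. z \<noteq> w \<longrightarrow> ?I a b z \<inter> ?I a b w = {}"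
      proof (intro ballI impI)
        fix z w assume zw: "z \<in> U \<times> V" "w \<in> U \<times> V" "z \<noteq> w"
        obtain x y x' y' where [simp]: "z = (x, y)" "w = (x', y')" by (cases z; cases w) auto
        have "x \<in> S" "y \<in> S" "x' \<in> S" "y' \<in> S" using zw UV by auto
        then show "?I a b z \<inter> ?I a b w = {}"
          using zw(3) disj[of x x'] disj[of y y'] unfolding prod.case Pair_inject \<open>z = _\<close> \<open>w = _\<close>
          by blast
      qed
    qed
    finally show ?thesis .
  qed
  have "card (?I \<alpha> \<beta> z) = card (?I \<alpha>' \<beta>' z)" if zUV: "z \<in> U \<times> V" for z
  proof -
    obtain x y where z: "z = (x, y)" "x \<in> S" "y \<in> S" using zUV UV by auto
    obtain c where "\<forall>(\<alpha>, \<beta>)\<in>t. card (x `` {\<alpha>} \<inter> y\<inverse> `` {\<beta>}) = c"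
      using intersection_constant[OF z(2,3) assms(3)] by blast
    from bspec[OF this assms(4)] bspec[OF this assms(5)] show ?thesis by (simp add: z(1))
  qed
  then show ?thesis unfolding eq by (rule sum.cong[OF refl])
qed

lemma ex1_is_coherent_closure:
  assumes fin: "finite \<Omega>" and T: "\<And>r. r \<in> T \<Longrightarrow> r \<subseteq> \<Omega> \<times> \<Omega>"
  shows "\<exists>!S. is_coherent_closure \<Omega> T S"
proof -
  define K where "K = {S. coherent_configuration \<Omega> S \<and> (\<forall>r\<in>T. union_of S r)}"
  have cc: "coherent_configuration \<Omega> S" if "S \<in> K" for S using that by (simp add: K_def)
  have part: "partition_on (\<Omega> \<times> \<Omega>) S" if "S \<in> K" for S
    using cc[OF that] by (rule coherent_configuration.partition)
  define D where "D = (\<lambda>p. {p}) ` (\<Omega> \<times> \<Omega>)"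
  have ccD: "coherent_configuration \<Omega> D"
    unfolding D_def by (rule coherent_configuration_discrete[OF fin])
  have "union_of D r" if "r \<in> T" for r
    unfolding union_of_partition_iff[OF coherent_configuration.partition[OF ccD]]
    using T[OF that] by (auto simp: D_def)
  then have DK: "D \<in> K" using ccD by (simp add: K_def)
  define R where "R = {(p, q). \<exists>S\<in>K. \<exists>s\<in>S. p \<in> s \<and> q \<in> s}"
  have RI: "(p, q) \<in> R" if "S \<in> K" "s \<in> S" "p \<in> s" "q \<in> s" for p q S s
    unfolding R_def by (intro CollectI case_prodI bexI conjI) (rule that)+
  define E where "E = R\<^sup>+"
  have block_sub: "s \<subseteq> \<Omega> \<times> \<Omega>" if "S \<in> K" "s \<in> S" for S s
    using partition_onD1[OF part[OF that(1)]] that(2) by blast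
  have R_sub: "R \<subseteq> (\<Omega> \<times> \<Omega>) \<times> (\<Omega> \<times> \<Omega>)"
  proof
    fix z assume "z \<in> R"
    then obtain p q S s where z: "z = (p, q)" "S \<in> K" "s \<in> S" "p \<in> s" "q \<in> s"
      by (auto simp: R_def)
    then have "p \<in> \<Omega> \<times> \<Omega>" "q \<in> \<Omega> \<times> \<Omega>"
      using block_sub[OF z(2,3)] by (auto dest: subsetD)
    then show "z \<in> (\<Omega> \<times> \<Omega>) \<times> (\<Omega> \<times> \<Omega>)" using z(1) by simp
  qed
  have equivE: "equiv (\<Omega> \<times> \<Omega>) E"
  proof (rule equivI)
    show "E \<subseteq> (\<Omega> \<times> \<Omega>) \<times> (\<Omega> \<times> \<Omega>)" unfolding E_def using R_sub by (rule trancl_subset_Sigma)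
    have "(p, p) \<in> R" if "p \<in> \<Omega> \<times> \<Omega>" for p
    proof -
      have "{p} \<in> D" unfolding D_def using that by (rule imageI)
      then show ?thesis by (intro RI[OF DK]) auto
    qed
    then have "(p, p) \<in> E" if "p \<in> \<Omega> \<times> \<Omega>" for p
      unfolding E_def using that by (intro r_into_trancl)
    then show "refl_on (\<Omega> \<times> \<Omega>) E"
      unfolding refl_on_def by blast
    show "sym E" unfolding E_def by (rule sym_trancl) (auto simp: R_def intro!: symI)
    show "trans E" unfolding E_def by (rule trans_trancl)
  qed
  define S where "S = (\<Omega> \<times> \<Omega>) // E"
  have partS: "partition_on (\<Omega> \<times> \<Omega>) S"
    unfolding S_def by (rule partition_on_quotient[OF equivE])
  have inE: "(p, q) \<in> E" if "s \<in> S" "p \<in> s" "q \<in> s" for p q s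
    using quotient_eq_iff[OF equivE] that unfolding S_def by blast
  have inS: "q \<in> s" if "s \<in> S" "p \<in> s" "(p, q) \<in> E" for p q s
    using in_quotient_imp_closed[OF equivE] that unfolding S_def by blast
  have transfer: "P q" if "(p, q) \<in> E" "P p" "\<And>p q. (p, q) \<in> R \<Longrightarrow> P p \<Longrightarrow> P q" for p q P
    using that(1,2) unfolding E_def by (induction rule: trancl_induct) (auto intro: that(3))
  have unionS: "union_of S r" if un: "\<And>S'. S' \<in> K \<Longrightarrow> union_of S' r" for r
  proof -
    have step: "q \<in> r" if pq: "(p, q) \<in> R" "p \<in> r" for p q
    proof -
      obtain S' s where S': "S' \<in> K" "s \<in> S'" "p \<in> s" "q \<in> s" using pq(1) by (auto simp: R_def)
      show ?thesis
        using un[OF S'(1)] S'(2-4) pq(2) unfolding union_of_partition_iff[OF part[OF S'(1)]]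
        by blast
    qed
    have "q \<in> r" if "s \<in> S" "p \<in> s" "q \<in> s" "p \<in> r" for s p q
      by (rule transfer[OF inE[OF that(1-3)], of "\<lambda>p. p \<in> r"]) (use that(4) step in auto)
    moreover have "r \<subseteq> \<Omega> \<times> \<Omega>"
      using un[OF DK] union_of_partition_iff[OF part[OF DK]] by blast
    ultimately show ?thesis unfolding union_of_partition_iff[OF partS] by blast
  qed
  have le: "union_of S' s" if "S' \<in> K" "s \<in> S" for S' s
  proof -
    have "q \<in> s" if "s' \<in> S'" "p \<in> s'" "q \<in> s'" "p \<in> s" for s' p q
    proof -
      have "(p, q) \<in> E" unfolding E_def using RI[OF \<open>S' \<in> K\<close> that(1-3)] by blast
      then show ?thesis using inS[OF \<open>s \<in> S\<close> \<open>p \<in> s\<close>] by blast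
    qed
    moreover have "s \<subseteq> \<Omega> \<times> \<Omega>" using partition_onD1[OF partS] that by blast
    ultimately show ?thesis unfolding union_of_partition_iff[OF part[OF that(1)]] by blast
  qed
  have ccS: "coherent_configuration \<Omega> S"
  proof
    show "finite \<Omega>" by fact
    show "partition_on (\<Omega> \<times> \<Omega>) S" by fact
    show "union_of S (Id_on \<Omega>)"
      by (rule unionS) (use cc coherent_configuration.diagonal in blast)
  next
    fix s assume s: "s \<in> S"
    have swapR: "(prod.swap p, prod.swap q) \<in> R" if pq: "(p, q) \<in> R" for p q
    proof -
      obtain S' s' where s': "S' \<in> K" "s' \<in> S'" "p \<in> s'" "q \<in> s'" using pq by (auto simp: R_def)
      then have "s'\<inverse> \<in> S'" using coherent_configuration.converse_closed[OF cc] by blast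
      moreover have "prod.swap p \<in> s'\<inverse>" "prod.swap q \<in> s'\<inverse>" using s' by (cases p; cases q; simp)+
      ultimately show ?thesis by (rule RI[OF s'(1)])
    qed
    have swapE: "(prod.swap p, prod.swap q) \<in> E" if "(p, q) \<in> E" for p q
      using that unfolding E_def
    proof (induction rule: trancl_induct)
      case (base q)
      then show ?case by (rule r_into_trancl[OF swapR])
    next
      case (step q q')
      show ?case by (rule trancl_into_trancl[OF step.IH swapR[OF step.hyps(2)]])
    qed
    obtain p where p: "p \<in> \<Omega> \<times> \<Omega>" "s = E `` {p}" using s unfolding S_def by (auto elim: quotientE)
    have "s\<inverse> = E `` {prod.swap p}"
    proof (rule set_eqI)
      fix q
      have "q \<in> s\<inverse> \<longleftrightarrow> (p, prod.swap q) \<in> E" by (cases q) (simp add: p(2))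
      also have "\<dots> \<longleftrightarrow> (prod.swap p, q) \<in> E"
        using swapE[of p "prod.swap q"] swapE[of "prod.swap p" q] unfolding swap_swap by blast
      finally show "q \<in> s\<inverse> \<longleftrightarrow> q \<in> E `` {prod.swap p}" by simp
    qed
    moreover have "prod.swap p \<in> \<Omega> \<times> \<Omega>" using p(1) by auto
    ultimately show "s\<inverse> \<in> S" unfolding S_def by (simp only: quotientI)
  next
    fix r s t assume rst: "r \<in> S" "s \<in> S" "t \<in> S"
    let ?f = "\<lambda>(\<alpha>, \<beta>). card (r `` {\<alpha>} \<inter> s\<inverse> `` {\<beta>})"
    have fR: "?f p = ?f q" if pq: "(p, q) \<in> R" for p q
    proof -
      obtain S' t' where t': "S' \<in> K" "t' \<in> S'" "p \<in> t'" "q \<in> t'" using pq by (auto simp: R_def)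
      then show ?thesis
        using coherent_configuration.card_union_constant[OF cc[OF t'(1)] le[OF t'(1) rst(1)]
            le[OF t'(1) rst(2)] t'(2), of "fst p" "snd p" "fst q" "snd q"]
        by (simp add: case_prod_beta)
    qed
    have "t \<noteq> {}" using rst(3) partition_onD3[OF partS] by auto
    then obtain p where p: "p \<in> t" by blast
    have "?f q = ?f p" if "q \<in> t" for q
      by (rule transfer[OF inE[OF rst(3) p that], of "\<lambda>q. ?f q = ?f p"]) (simp_all add: fR)
    then show "\<exists>c. \<forall>(\<alpha>, \<beta>)\<in>t. card (r `` {\<alpha>} \<inter> s\<inverse> `` {\<beta>}) = c"
      by (intro exI[of _ "?f p"]) auto
  qed
  have closS: "is_coherent_closure \<Omega> T S"
    unfolding is_coherent_closure_def conf_le_def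
    using ccS le unionS by (auto simp: K_def)
  moreover have "S' = S" if "is_coherent_closure \<Omega> T S'" for S'
  proof -
    have S'K: "S' \<in> K" using that by (simp add: is_coherent_closure_def K_def)
    have "conf_le S' S"
      using that closS unfolding is_coherent_closure_def by blast
    then have le': "union_of S s" if "s \<in> S'" for s
      using that unfolding conf_le_def by blast
    have eq: "s = s'" if "s \<in> S" "s' \<in> S'" "p \<in> s" "p \<in> s'" for s s' p
    proof
      show "s \<subseteq> s'" using le'[OF that(2)] that unfolding union_of_partition_iff[OF partS] by blast
      show "s' \<subseteq> s" using le[OF S'K that(1)] that unfolding union_of_partition_iff[OF part[OF S'K]] by blast
    qed
    have half: "A \<subseteq> B"
      if A: "partition_on (\<Omega> \<times> \<Omega>) A" and B: "partition_on (\<Omega> \<times> \<Omega>) B"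
        and AB: "\<And>a b p. a \<in> A \<Longrightarrow> b \<in> B \<Longrightarrow> p \<in> a \<Longrightarrow> p \<in> b \<Longrightarrow> a = b" for A B
    proof
      fix a assume a: "a \<in> A"
      then have "a \<noteq> {}" using partition_onD3[OF A] by auto
      then obtain p where p: "p \<in> a" by blast
      then have "p \<in> \<Union>B" using a partition_onD1[OF A] partition_onD1[OF B] by blast
      then obtain b where b: "b \<in> B" "p \<in> b" by blast
      show "a \<in> B" using AB[OF a b(1) p b(2)] b(1) by simp
    qed
    show ?thesis
    proof
      show "S' \<subseteq> S" by (rule half[OF part[OF S'K] partS]) (rule eq[symmetric])
      show "S \<subseteq> S'" by (rule half[OF partS part[OF S'K]]) (rule eq)
    qed
  qed
  ultimately show ?thesis by blast
qed

lemma is_coherent_closure_WL: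
  assumes "finite \<Omega>" "\<And>r. r \<in> T \<Longrightarrow> r \<subseteq> \<Omega> \<times> \<Omega>"
  shows "is_coherent_closure \<Omega> T (WL \<Omega> T)"
  unfolding WL_def by (rule theI') (rule ex1_is_coherent_closure[OF assms])

lemma is_coherent_closure_WL_point:
  assumes "pair_graph X" "\<alpha> \<in> pverts X"
  shows "is_coherent_closure (pverts X) {parcs X, {(\<alpha>, \<alpha>)}} (WL_point X \<alpha>)"
proof -
  interpret pair_graph X by fact
  show ?thesis unfolding WL_point_def
    by (rule is_coherent_closure_WL) (use assms in_arcsD1 in_arcsD2 in auto)
qed

definition algebraic_isomorphism ::
  "'a rel set \<Rightarrow> 'b rel set \<Rightarrow> ('a rel \<Rightarrow> 'b rel) \<Rightarrow> bool" where
  "algebraic_isomorphism S S' \<phi> \<longleftrightarrow>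
     bij_betw \<phi> S S' \<and>
     (\<forall>r\<in>S. \<forall>s\<in>S. \<forall>t\<in>S.
        intersection_number r s t = intersection_number (\<phi> r) (\<phi> s) (\<phi> t))"

definition combinatorial_isomorphism ::
  "'a set \<Rightarrow> 'a rel set \<Rightarrow> 'b set \<Rightarrow> 'b rel set \<Rightarrow> ('a \<Rightarrow> 'b) \<Rightarrow> bool" where
  "combinatorial_isomorphism \<Omega> S \<Omega>' S' f \<longleftrightarrow>
     bij_betw f \<Omega> \<Omega>' \<and> (\<forall>s\<in>S. map_prod f f ` s \<in> S')"

text \<open>HOL cannot quantify over types inside a definition, so the type of the points of the second
  configuration is a parameter. Separability proper is \<open>separable TYPE('b) \<Omega> S\<close> for every type
  \<open>'b\<close>, i.e. for a type variable \<open>'b\<close> left free in a theorem.\<close>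

definition separable :: "'b itself \<Rightarrow> 'a set \<Rightarrow> 'a rel set \<Rightarrow> bool" where
  "separable (_ :: 'b itself) \<Omega> S \<longleftrightarrow>
     coherent_configuration \<Omega> S \<and>
     (\<forall>(\<Omega>' :: 'b set) S' \<phi>.
        coherent_configuration \<Omega>' S' \<and> algebraic_isomorphism S S' \<phi> \<longrightarrow>
        (\<exists>f. combinatorial_isomorphism \<Omega> S \<Omega>' S' f \<and> (\<forall>s\<in>S. \<phi> s = map_prod f f ` s)))"

end

theory Submission
  imports Defs
begin

text \<open>In a biregular bipartite graph without induced cycles of length at least 6, two vertices of
  the same part with a common neighbour have the same neighbours, so every component is complete
  bipartite. This applies to the edges between any two fibers of \<open>WL(X\<^sub>\<alpha>)\<close>. By induction on the
  distance from \<open>\<alpha>\<close>, the absence of the bipartite claw leaves at most two components between any two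
  fibers, and the absence of an induced 8-cycle makes the resulting bipartition of a fiber unique:
  its classes are the twin classes.

  Call two fibers linked if there are edges and non-edges between them. Fixing one base point in each
  linkage class, the basis relation from the base point to a vertex determines its twin class.
  Given an algebraic isomorphism, choose images of the base points and a bijection that respects the
  basis relations from them. It respects adjacency, and a bijection that respects the generating
  relations of a coherent closure induces the algebraic isomorphism.\<close>

section \<open>Coherent configurations\<close>

text \<open>The root cannot serve as the only base point: its fiber is a singleton, so the basis
  relation from \<alpha> to a vertex records just the fiber of that vertex and cannot tell two twin
  classes of the fiber apart. What the root does give is that every fiber lies in one sphere around
  \<alpha>; this makes the induction on distance possible and supplies the third leg of the claw.
  Between linked fibers, singling out a twin class in one singles out a twin class in the other, so
  one base point settles a whole linkage class. Between unlinked fibers adjacency depends on the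
  fibers alone, so the images of base points of different linkage classes can be chosen
  independently. The basis relations of \<open>WL_point X \<alpha>\<close> are never computed. The
  bijection is controlled only relative to the base points, which is enough for adjacency;
  minimality of the closure then extends the agreement to all basis relations.\<close>

context coherent_configuration
begin

definition rel :: "'a \<Rightarrow> 'a \<Rightarrow> 'a rel" where
  "rel x y = (THE s. s \<in> S \<and> (x, y) \<in> s)"

text \<open>By (C1) \<open>rel x x\<close> is a subset of the diagonal; \<open>fib x\<close> is its
  support, the fiber of \<open>x\<close>.\<close>

definition fib :: "'a \<Rightarrow> 'a set" where
  "fib x = {y \<in> \<Omega>. rel y y = rel x x}"

lemma block_subset: "s \<in> S \<Longrightarrow> s \<subseteq> \<Omega> \<times> \<Omega>"
  using partition_onD1[OF partition] by blast

lemma block_in: "s \<in> S \<Longrightarrow> (x, y) \<in> s \<Longrightarrow> x \<in> \<Omega> \<and> y \<in> \<Omega>"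
  using block_subset by blast

lemma block_eq: "s \<in> S \<Longrightarrow> t \<in> S \<Longrightarrow> p \<in> s \<Longrightarrow> p \<in> t \<Longrightarrow> s = t"
  using partition_onD2[OF partition] by (auto simp: disjoint_def)

lemma rel_eq: "s \<in> S \<Longrightarrow> (x, y) \<in> s \<Longrightarrow> rel x y = s"
  unfolding rel_def by (rule the_equality) (use block_eq in \<open>blast+\<close>)

lemma rel_mem: "x \<in> \<Omega> \<Longrightarrow> y \<in> \<Omega> \<Longrightarrow> rel x y \<in> S"
  and in_rel: "x \<in> \<Omega> \<Longrightarrow> y \<in> \<Omega> \<Longrightarrow> (x, y) \<in> rel x y"
proof -
  assume xy: "x \<in> \<Omega>" "y \<in> \<Omega>"
  then obtain s where s: "s \<in> S" "(x, y) \<in> s" using partition_onD1[OF partition] by blast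
  show "rel x y \<in> S" "(x, y) \<in> rel x y" unfolding rel_eq[OF s] by fact+
qed

lemma blockE:
  assumes "s \<in> S"
  obtains x y where "x \<in> \<Omega>" "y \<in> \<Omega>" "s = rel x y"
proof -
  have "s \<noteq> {}" using assms partition_onD3[OF partition] by auto
  then obtain x y where "(x, y) \<in> s" by auto
  then show thesis using that[of x y] assms block_in[OF assms] rel_eq[OF assms] by auto
qed

text \<open>Treats basis relations as colours of pairs, so that unions of basis relations become
  colour-invariant relations and later arguments can speak of points instead of blocks.\<close>

lemma union_of_iff:
  "union_of S r \<longleftrightarrow> r \<subseteq> \<Omega> \<times> \<Omega> \<and> (\<forall>x\<in>\<Omega>. \<forall>y\<in>\<Omega>. \<forall>u\<in>\<Omega>. \<forall>v\<in>\<Omega>.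
     rel x y = rel u v \<longrightarrow> (x, y) \<in> r \<longrightarrow> (u, v) \<in> r)" (is "_ \<longleftrightarrow> ?R")
proof -
  have "?R \<longleftrightarrow> r \<subseteq> \<Omega> \<times> \<Omega> \<and> (\<forall>s\<in>S. \<forall>p\<in>s. \<forall>q\<in>s. p \<in> r \<longrightarrow> q \<in> r)"
  proof (intro conj_cong refl iffI ballI impI)
    fix s p q
    assume R: "\<forall>x\<in>\<Omega>. \<forall>y\<in>\<Omega>. \<forall>u\<in>\<Omega>. \<forall>v\<in>\<Omega>. rel x y = rel u v \<longrightarrow> (x, y) \<in> r \<longrightarrow> (u, v) \<in> r"
      and s: "s \<in> S" "p \<in> s" "q \<in> s" "p \<in> r"
    obtain x y u v where [simp]: "p = (x, y)" "q = (u, v)" by (cases p; cases q)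
    have "x \<in> \<Omega>" "y \<in> \<Omega>" "u \<in> \<Omega>" "v \<in> \<Omega>"
      using s block_in[OF s(1)] by auto
    moreover have "rel x y = rel u v"
      using s rel_eq[OF s(1), of x y] rel_eq[OF s(1), of u v] by simp
    moreover have "(x, y) \<in> r" using s by simp
    ultimately have "(u, v) \<in> r" using R by blast
    then show "q \<in> r" by simp
  next
    fix x y u v
    assume R: "\<forall>s\<in>S. \<forall>p\<in>s. \<forall>q\<in>s. p \<in> r \<longrightarrow> q \<in> r"
      and xy: "x \<in> \<Omega>" "y \<in> \<Omega>" "u \<in> \<Omega>" "v \<in> \<Omega>" "rel x y = rel u v" "(x, y) \<in> r"
    have "(u, v) \<in> rel x y" using in_rel[OF xy(3,4)] xy(5) by simp
    then show "(u, v) \<in> r" using R rel_mem[OF xy(1,2)] in_rel[OF xy(1,2)] xy(6) by blast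
  qed
  then show ?thesis using union_of_partition_iff[OF partition] by simp
qed

lemma union_of_imp:
  assumes "union_of S r" "rel x y = rel u v" "x \<in> \<Omega>" "y \<in> \<Omega>" "u \<in> \<Omega>" "v \<in> \<Omega>" "(x, y) \<in> r"
  shows "(u, v) \<in> r"
  using assms(1)[unfolded union_of_iff, THEN conjunct2, rule_format, OF assms(3-6,2,7)] .

lemma union_of_rel:
  assumes "union_of S r" "rel x y = rel u v" "x \<in> \<Omega>" "y \<in> \<Omega>" "u \<in> \<Omega>" "v \<in> \<Omega>"
  shows "(x, y) \<in> r \<longleftrightarrow> (u, v) \<in> r"
proof
  show "(x, y) \<in> r \<Longrightarrow> (u, v) \<in> r" by (rule union_of_imp[OF assms])
  show "(u, v) \<in> r \<Longrightarrow> (x, y) \<in> r" by (rule union_of_imp[OF assms(1) assms(2)[symmetric] assms(5,6,3,4)])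
qed

lemma union_of_subset_iff:
  "union_of S r \<Longrightarrow> x \<in> \<Omega> \<Longrightarrow> y \<in> \<Omega> \<Longrightarrow> rel x y \<subseteq> r \<longleftrightarrow> (x, y) \<in> r"
proof
  assume r: "union_of S r" and xy: "x \<in> \<Omega>" "y \<in> \<Omega>" "(x, y) \<in> r"
  show "rel x y \<subseteq> r"
  proof
    fix p assume p: "p \<in> rel x y"
    obtain u v where uv: "p = (u, v)" by (cases p)
    have "u \<in> \<Omega>" "v \<in> \<Omega>" "rel x y = rel u v"
      using p uv block_in[OF rel_mem[OF xy(1,2)]] rel_eq[OF rel_mem[OF xy(1,2)]] by blast+
    then show "p \<in> r" using union_of_imp[OF r _ xy(1,2) _ _ xy(3)] uv by blast
  qed
qed (use in_rel in blast)

lemma rel_converse: "x \<in> \<Omega> \<Longrightarrow> y \<in> \<Omega> \<Longrightarrow> rel y x = (rel x y)\<inverse>"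
  by (rule rel_eq[OF converse_closed[OF rel_mem]]) (use in_rel in blast)+

lemma rel_swap: "rel x y = rel u v \<Longrightarrow> x \<in> \<Omega> \<Longrightarrow> y \<in> \<Omega> \<Longrightarrow> u \<in> \<Omega> \<Longrightarrow> v \<in> \<Omega> \<Longrightarrow> rel y x = rel v u"
  by (simp add: rel_converse[of x y] rel_converse[of u v])

section \<open>Intersection numbers and triangles\<close>

lemma card_intersection:
  assumes "r \<in> S" "s \<in> S" "t \<in> S" "(x, y) \<in> t"
  shows "card (r `` {x} \<inter> s\<inverse> `` {y}) = intersection_number r s t"
proof -
  obtain c where c: "\<forall>(x, y)\<in>t. card (r `` {x} \<inter> s\<inverse> `` {y}) = c"
    using intersection_constant[OF assms(1-3)] by blast
  then have "intersection_number r s t = c"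
    unfolding intersection_number_def using assms(4)
    by (intro the_equality) (auto dest: bspec[OF _ assms(4)])
  then show ?thesis using c assms(4) by auto
qed

lemma intersection_number_pos_iff:
  assumes "r \<in> S" "s \<in> S" "x \<in> \<Omega>" "y \<in> \<Omega>"
  shows "intersection_number r s (rel x y) > 0 \<longleftrightarrow> (\<exists>z\<in>\<Omega>. rel x z = r \<and> rel z y = s)"
proof -
  have "r `` {x} \<inter> s\<inverse> `` {y} \<subseteq> \<Omega>" using block_in[OF assms(1)] by blast
  then have "finite (r `` {x} \<inter> s\<inverse> `` {y})" using finite_points finite_subset by blast
  then have "intersection_number r s (rel x y) > 0 \<longleftrightarrow> r `` {x} \<inter> s\<inverse> `` {y} \<noteq> {}"
    using card_intersection[OF assms(1,2) rel_mem[OF assms(3,4)] in_rel[OF assms(3,4)]]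
    by (metis card_gt_0_iff)
  also have "\<dots> \<longleftrightarrow> (\<exists>z\<in>\<Omega>. rel x z = r \<and> rel z y = s)"
    using rel_eq[OF assms(1)] rel_eq[OF assms(2)] block_in[OF assms(1)] in_rel assms by blast
  finally show ?thesis .
qed

text \<open>By (C3) the number of triangles of given colours over a pair depends only on the colour
  of the pair, so a triangle over one pair has a copy over every pair of the same colour.\<close>

lemma triangle:
  assumes "rel x y = rel u v" "x \<in> \<Omega>" "y \<in> \<Omega>" "u \<in> \<Omega>" "v \<in> \<Omega>" "z \<in> \<Omega>"
  obtains w where "w \<in> \<Omega>" "rel x z = rel u w" "rel z y = rel w v"
proof -
  have "intersection_number (rel x z) (rel z y) (rel x y) > 0"
    unfolding intersection_number_pos_iff[OF rel_mem[OF assms(2,6)] rel_mem[OF assms(6,3)] assms(2,3)]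
    using assms(6) by blast
  then have "intersection_number (rel x z) (rel z y) (rel u v) > 0" by (simp only: assms(1))
  then have "\<exists>w\<in>\<Omega>. rel u w = rel x z \<and> rel w v = rel z y"
    unfolding intersection_number_pos_iff[OF rel_mem[OF assms(2,6)] rel_mem[OF assms(6,3)] assms(4,5)] .
  then show thesis using that by metis
qed

lemma rel_diag: "rel x y = rel z z \<Longrightarrow> x \<in> \<Omega> \<Longrightarrow> y \<in> \<Omega> \<Longrightarrow> z \<in> \<Omega> \<Longrightarrow> x = y"
  using union_of_imp[OF diagonal sym, of x y z z] by blast

text \<open>The degenerate triangle \<open>x\<close>, \<open>x\<close>, \<open>y\<close> is copied
  over \<open>(u, v)\<close>; its third point has a diagonal relation with \<open>u\<close> and is
  therefore \<open>u\<close> itself.\<close>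

lemma rel_source:
  assumes "rel x y = rel u v" "x \<in> \<Omega>" "y \<in> \<Omega>" "u \<in> \<Omega>" "v \<in> \<Omega>"
  shows "rel x x = rel u u"
proof -
  obtain w where w: "w \<in> \<Omega>" "rel x x = rel u w" by (rule triangle[OF assms assms(2)])
  have "u = w" by (rule rel_diag[OF w(2)[symmetric] assms(4) w(1) assms(2)])
  then show ?thesis using w by simp
qed

lemma rel_target:
  assumes "rel x y = rel u v" "x \<in> \<Omega>" "y \<in> \<Omega>" "u \<in> \<Omega>" "v \<in> \<Omega>"
  shows "rel y y = rel v v"
  by (rule rel_source[OF rel_swap[OF assms] assms(3,2,5,4)])

section \<open>Fibers and degrees\<close>

lemma fib_mem [simp]: "x \<in> \<Omega> \<Longrightarrow> x \<in> fib x"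
  and fib_subset: "fib x \<subseteq> \<Omega>"
  and fib_eq: "y \<in> fib x \<Longrightarrow> fib y = fib x"
  and fib_sym: "y \<in> fib x \<Longrightarrow> x \<in> \<Omega> \<Longrightarrow> x \<in> fib y"
  by (auto simp: fib_def)

text \<open>Restricting the targets of \<open>r\<close> to one fiber keeps it a union of basis
  relations, and points of one fiber have the same diagonal relation. Applied to adjacency, this
  makes the graph between two fibers biregular.\<close>

lemma card_neighbours_fib:
  assumes r: "union_of S r" and xy: "x \<in> \<Omega>" "y \<in> fib x"
  shows "card (r `` {x} \<inter> fib z) = card (r `` {y} \<inter> fib z)"
proof -
  let ?r = "r \<inter> (\<Omega> \<times> fib z)"
  have y: "y \<in> \<Omega>" using xy fib_subset by blast
  have u: "union_of S ?r"
    unfolding union_of_iff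
  proof (intro conjI ballI impI)
    fix a b c d assume *: "a \<in> \<Omega>" "b \<in> \<Omega>" "c \<in> \<Omega>" "d \<in> \<Omega>" "rel a b = rel c d" "(a, b) \<in> ?r"
    have "rel b b = rel d d" by (rule rel_target[OF *(5,1-4)])
    moreover have "(c, d) \<in> r" by (rule union_of_imp[OF r *(5,1-4)]) (use *(6) in blast)
    ultimately show "(c, d) \<in> ?r" using * by (simp add: fib_def)
  qed (auto simp: fib_def)
  have u': "union_of S (?r\<inverse>)"
    unfolding union_of_iff
  proof (intro conjI ballI impI)
    fix a b c d assume *: "a \<in> \<Omega>" "b \<in> \<Omega>" "c \<in> \<Omega>" "d \<in> \<Omega>" "rel a b = rel c d" "(a, b) \<in> ?r\<inverse>"
    have "(d, c) \<in> ?r" by (rule union_of_imp[OF u rel_swap[OF *(5,1-4)] *(2,1,4,3)]) (use *(6) in blast)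
    then show "(c, d) \<in> ?r\<inverse>" by blast
  qed (auto simp: fib_def)
  have "(x, x) \<in> rel x x" "(y, y) \<in> rel x x"
    using xy y in_rel[of y y] in_rel[of x x] by (auto simp: fib_def)
  \<comment> \<open>With the converse as second relation and a diagonal pair, the two-sided count
    collapses to the number of out-neighbours.\<close>
  from card_union_constant[OF u u' rel_mem[OF xy(1) xy(1)] this]
  have "card (?r `` {x}) = card (?r `` {y})" by simp
  moreover have "?r `` {w} = r `` {w} \<inter> fib z" if "w \<in> \<Omega>" for w using that by blast
  ultimately show ?thesis using xy y by simp
qed

text \<open>Expresses a count for merged relations through intersection numbers, the data that an
  algebraic isomorphism preserves.\<close>

lemma card_union_sum:
  assumes "U \<subseteq> S" "V \<subseteq> S" "x \<in> \<Omega>" "y \<in> \<Omega>"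
  shows "card {z \<in> \<Omega>. rel x z \<in> U \<and> rel z y \<in> V} =
    (\<Sum>(u, v)\<in>U \<times> V. intersection_number u v (rel x y))"
proof -
  have "finite S" using finite_elements[OF _ partition] finite_points by simp
  then have fin: "finite (U \<times> V)" using assms by (auto intro: finite_subset)
  let ?I = "\<lambda>(u, v). {z \<in> \<Omega>. rel x z = u \<and> rel z y = v}"
  have "{z \<in> \<Omega>. rel x z \<in> U \<and> rel z y \<in> V} = (\<Union>p\<in>U \<times> V. ?I p)" by auto
  also have "card \<dots> = (\<Sum>p\<in>U \<times> V. card (?I p))"
    by (rule card_UN_disjoint[OF fin]) (use finite_points in auto)
  also have "\<dots> = (\<Sum>(u, v)\<in>U \<times> V. intersection_number u v (rel x y))"
  proof (rule sum.cong[OF refl])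
    fix p assume "p \<in> U \<times> V"
    then obtain u v where p: "p = (u, v)" "u \<in> S" "v \<in> S" using assms by blast
    have "?I p = u `` {x} \<inter> v\<inverse> `` {y}"
    proof (intro set_eqI iffI)
      fix z assume "z \<in> ?I p"
      then show "z \<in> u `` {x} \<inter> v\<inverse> `` {y}"
        using in_rel[of x z] in_rel[of z y] assms(3,4) by (auto simp: p(1))
    next
      fix z assume "z \<in> u `` {x} \<inter> v\<inverse> `` {y}"
      then have z: "(x, z) \<in> u" "(z, y) \<in> v" by blast+
      then show "z \<in> ?I p"
        using rel_eq[OF p(2) z(1)] rel_eq[OF p(3) z(2)] block_in[OF p(2) z(1)] by (simp add: p(1))
    qed
    then show "card (?I p) = (case p of (u, v) \<Rightarrow> intersection_number u v (rel x y))"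
      using card_intersection[OF p(2,3) rel_mem[OF assms(3,4)] in_rel[OF assms(3,4)]] p(1) by simp
  qed
  finally show ?thesis .
qed

text \<open>The valency is itself an intersection number, so algebraic isomorphisms preserve
  it.\<close>

lemma card_rel_image:
  assumes "x \<in> \<Omega>" "y \<in> \<Omega>"
  shows "card (rel x y `` {x}) = intersection_number (rel x y) (rel y x) (rel x x)"
  using card_intersection[OF rel_mem[of x y] rel_mem[of y x] rel_mem[of x x] in_rel[of x x]] assms
  by (simp add: rel_converse[of x y])

end

section \<open>Algebraic isomorphisms of coherent closures\<close>

lemma (in coherent_configuration) rel_image:
  assumes "x \<in> \<Omega>" "y \<in> \<Omega>"
  shows "{z \<in> \<Omega>. rel x z = rel x y} = rel x y `` {x}"
proof (intro set_eqI iffI)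
  fix z assume "z \<in> {z \<in> \<Omega>. rel x z = rel x y}"
  then show "z \<in> rel x y `` {x}" using in_rel[OF assms(1), of z] by auto
next
  fix z assume "z \<in> rel x y `` {x}"
  then have z: "(x, z) \<in> rel x y" by blast
  show "z \<in> {z \<in> \<Omega>. rel x z = rel x y}"
    using rel_eq[OF rel_mem[OF assms] z] block_in[OF rel_mem[OF assms] z] by blast
qed

locale algebraic_iso = X: coherent_configuration \<Omega> S + Y: coherent_configuration \<Omega>' S'
  for \<Omega> :: "'a set" and S and \<Omega>' :: "'b set" and S' +
  fixes \<phi> :: "'a rel \<Rightarrow> 'b rel"
  assumes iso: "algebraic_isomorphism S S' \<phi>"
begin

lemma bij: "bij_betw \<phi> S S'"
  using iso unfolding algebraic_isomorphism_def by blast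

lemma iso_mem: "s \<in> S \<Longrightarrow> \<phi> s \<in> S'"
  using bij bij_betwE by blast

lemma iso_inj: "s \<in> S \<Longrightarrow> t \<in> S \<Longrightarrow> \<phi> s = \<phi> t \<Longrightarrow> s = t"
  using bij unfolding bij_betw_def inj_on_def by blast

lemma iso_surjE:
  assumes "x' \<in> \<Omega>'" "y' \<in> \<Omega>'"
  obtains x y where "x \<in> \<Omega>" "y \<in> \<Omega>" "\<phi> (X.rel x y) = Y.rel x' y'"
proof -
  have "Y.rel x' y' \<in> \<phi> ` S"
    using bij_betw_imp_surj_on[OF bij] Y.rel_mem[OF assms] by simp
  then obtain s where s: "s \<in> S" "\<phi> s = Y.rel x' y'" by fastforce
  obtain x y where "x \<in> \<Omega>" "y \<in> \<Omega>" "s = X.rel x y" by (rule X.blockE[OF s(1)])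
  then show thesis using s that by blast
qed

lemma iso_number: "r \<in> S \<Longrightarrow> s \<in> S \<Longrightarrow> t \<in> S \<Longrightarrow>
    intersection_number (\<phi> r) (\<phi> s) (\<phi> t) = intersection_number r s t"
  using iso unfolding algebraic_isomorphism_def by simp

text \<open>Positivity of an intersection number means that a triangle exists; this is how
  \<open>\<phi>\<close>, a map on relations, moves configurations of points in both
  directions.\<close>

lemma iso_triangle_iff:
  assumes "r \<in> S" "s \<in> S" "x \<in> \<Omega>" "y \<in> \<Omega>" "x' \<in> \<Omega>'" "y' \<in> \<Omega>'"
    and xy: "\<phi> (X.rel x y) = Y.rel x' y'"
  shows "(\<exists>z\<in>\<Omega>. X.rel x z = r \<and> X.rel z y = s) \<longleftrightarrow>
    (\<exists>z'\<in>\<Omega>'. Y.rel x' z' = \<phi> r \<and> Y.rel z' y' = \<phi> s)"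
  unfolding X.intersection_number_pos_iff[OF assms(1-4), symmetric]
    Y.intersection_number_pos_iff[OF iso_mem[OF assms(1)] iso_mem[OF assms(2)] assms(5,6), symmetric]
    xy[symmetric] iso_number[OF assms(1,2) X.rel_mem[OF assms(3,4)]] ..

lemma iso_triangle:
  assumes "x \<in> \<Omega>" "y \<in> \<Omega>" "z \<in> \<Omega>" "x' \<in> \<Omega>'" "y' \<in> \<Omega>'" "\<phi> (X.rel x y) = Y.rel x' y'"
  obtains z' where "z' \<in> \<Omega>'" "\<phi> (X.rel x z) = Y.rel x' z'" "\<phi> (X.rel z y) = Y.rel z' y'"
proof -
  have "\<exists>z'\<in>\<Omega>'. Y.rel x' z' = \<phi> (X.rel x z) \<and> Y.rel z' y' = \<phi> (X.rel z y)"
    using iso_triangle_iff[OF X.rel_mem[OF assms(1,3)] X.rel_mem[OF assms(3,2)] assms(1,2,4-6)]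
      assms(3) by blast
  then show thesis using that by metis
qed

text \<open>Intersection numbers detect the diagonal. Let \<open>rel u v\<close> be the preimage of
  the diagonal relation of \<open>y'\<close>. The degenerate triangle \<open>x'\<close>,
  \<open>y'\<close>, \<open>y'\<close> pulls back to a point \<open>z\<close> over
  \<open>(x, x)\<close> with \<open>rel x z\<close> diagonal, so \<open>z = x\<close> and
  \<open>rel u v = rel x x\<close>; hence the relation of \<open>(x', y')\<close> is that of
  \<open>(y', y')\<close>.\<close>

lemma iso_diag:
  assumes "x \<in> \<Omega>" "x' \<in> \<Omega>'" "y' \<in> \<Omega>'" and xy: "\<phi> (X.rel x x) = Y.rel x' y'"
  shows "x' = y'"
proof -
  obtain u v where uv: "u \<in> \<Omega>" "v \<in> \<Omega>" "\<phi> (X.rel u v) = Y.rel y' y'"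
    by (rule iso_surjE[OF assms(3,3)])
  have "\<exists>z\<in>\<Omega>. X.rel x z = X.rel x x \<and> X.rel z x = X.rel u v"
    unfolding iso_triangle_iff[OF X.rel_mem[OF assms(1,1)] X.rel_mem[OF uv(1,2)] assms(1,1-3) xy]
    using uv(3) xy assms(3) by auto
  then obtain z where z: "z \<in> \<Omega>" "X.rel x z = X.rel x x" "X.rel z x = X.rel u v" by blast
  have "x = z" by (rule X.rel_diag[OF z(2) assms(1) z(1) assms(1)])
  then have "Y.rel x' y' = Y.rel y' y'" using z(3) uv(3) xy by simp
  then show ?thesis by (rule Y.rel_diag[OF _ assms(2,3,3)])
qed

lemma iso_source:
  assumes "x \<in> \<Omega>" "y \<in> \<Omega>" "x' \<in> \<Omega>'" "y' \<in> \<Omega>'" "\<phi> (X.rel x y) = Y.rel x' y'"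
  shows "\<phi> (X.rel x x) = Y.rel x' x'"
proof -
  obtain z' where z: "z' \<in> \<Omega>'" "\<phi> (X.rel x x) = Y.rel x' z'"
    by (rule iso_triangle[OF assms(1,2,1,3-5)])
  then show ?thesis using iso_diag[OF assms(1,3) z] by simp
qed

lemma iso_extend:
  assumes "x \<in> \<Omega>" "y \<in> \<Omega>" "x' \<in> \<Omega>'" "\<phi> (X.rel x x) = Y.rel x' x'"
  obtains y' where "y' \<in> \<Omega>'" "\<phi> (X.rel x y) = Y.rel x' y'" "\<phi> (X.rel y x) = Y.rel y' x'"
  by (rule iso_triangle[OF assms(1,1,2,3,3,4)])

text \<open>A pair and its converse form a triangle over a diagonal pair, and diagonal relations are
  preserved.\<close>

lemma iso_swap:
  assumes "x \<in> \<Omega>" "y \<in> \<Omega>" "x' \<in> \<Omega>'" "y' \<in> \<Omega>'" "\<phi> (X.rel x y) = Y.rel x' y'"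
  shows "\<phi> (X.rel y x) = Y.rel y' x'"
proof -
  obtain z' where z: "z' \<in> \<Omega>'" "\<phi> (X.rel x y) = Y.rel x' z'" "\<phi> (X.rel y x) = Y.rel z' x'"
    by (rule iso_extend[OF assms(1-3) iso_source[OF assms]])
  have "Y.rel z' x' = Y.rel y' x'"
    by (rule Y.rel_swap) (use z assms in simp_all)
  then show ?thesis using z by simp
qed

lemma iso_target:
  assumes "x \<in> \<Omega>" "y \<in> \<Omega>" "x' \<in> \<Omega>'" "y' \<in> \<Omega>'" "\<phi> (X.rel x y) = Y.rel x' y'"
  shows "\<phi> (X.rel y y) = Y.rel y' y'"
  by (rule iso_source[OF assms(2,1,4,3) iso_swap[OF assms]])

lemma iso_inverse: "algebraic_iso \<Omega>' S' \<Omega> S (inv_into S \<phi>)"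
proof -
  have inv: "inv_into S \<phi> s \<in> S" "\<phi> (inv_into S \<phi> s) = s" if "s \<in> S'" for s
    using that bij_betw_imp_surj_on[OF bij] by (metis inv_into_into f_inv_into_f)+
  show ?thesis
  proof unfold_locales
    show "algebraic_isomorphism S' S (inv_into S \<phi>)"
      unfolding algebraic_isomorphism_def
    proof (intro conjI ballI)
      show "bij_betw (inv_into S \<phi>) S' S" by (rule bij_betw_inv_into[OF bij])
      fix r s t assume rst: "r \<in> S'" "s \<in> S'" "t \<in> S'"
      show "intersection_number r s t =
          intersection_number (inv_into S \<phi> r) (inv_into S \<phi> s) (inv_into S \<phi> t)"
        using iso_number[OF inv(1)[OF rst(1)] inv(1)[OF rst(2)] inv(1)[OF rst(3)]]
        unfolding inv(2)[OF rst(1)] inv(2)[OF rst(2)] inv(2)[OF rst(3)] .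
    qed
  qed
qed

lemma iso_diag':
  assumes "x \<in> \<Omega>" "y \<in> \<Omega>" "x' \<in> \<Omega>'" "\<phi> (X.rel x y) = Y.rel x' x'"
  shows "x = y"
proof -
  interpret I: algebraic_iso \<Omega>' S' \<Omega> S "inv_into S \<phi>" by (rule iso_inverse)
  have "inv_into S \<phi> (Y.rel x' x') = X.rel x y"
    unfolding assms(4)[symmetric]
    by (rule inv_into_f_f) (use bij X.rel_mem assms in \<open>auto simp: bij_betw_def\<close>)
  then show ?thesis by (rule I.iso_diag[OF assms(3,1,2)])
qed

lemma iso_valency:
  assumes "x \<in> \<Omega>" "y \<in> \<Omega>" "x' \<in> \<Omega>'" "\<phi> (X.rel x x) = Y.rel x' x'"
  shows "card {z \<in> \<Omega>. X.rel x z = X.rel x y} = card {z \<in> \<Omega>'. Y.rel x' z = \<phi> (X.rel x y)}"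
proof -
  obtain y' where y': "y' \<in> \<Omega>'" "\<phi> (X.rel x y) = Y.rel x' y'" "\<phi> (X.rel y x) = Y.rel y' x'"
    by (rule iso_extend[OF assms])
  have "{z \<in> \<Omega>. X.rel x z = X.rel x y} = X.rel x y `` {x}"
    by (rule X.rel_image[OF assms(1,2)])
  moreover have "{z \<in> \<Omega>'. Y.rel x' z = Y.rel x' y'} = Y.rel x' y' `` {x'}"
    by (rule Y.rel_image[OF assms(3) y'(1)])
  moreover have "intersection_number (\<phi> (X.rel x y)) (\<phi> (X.rel y x)) (\<phi> (X.rel x x)) =
      intersection_number (X.rel x y) (X.rel y x) (X.rel x x)"
    by (rule iso_number) (use X.rel_mem assms in auto)
  ultimately show ?thesis
    using X.card_rel_image[OF assms(1,2)] Y.card_rel_image[OF assms(3) y'(1)] y'(2,3) assms(4) by simp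
qed


text \<open>Link a basis relation \<open>s\<close> to \<open>t\<close> if \<open>f\<close> maps some pair of \<open>s\<close> into \<open>\<phi> t\<close>. Merging the linked
  basis relations gives a coherent configuration that still resolves \<open>T\<close>, so by minimality of
  the closure every link is trivial.\<close>

lemma induced_by_bijection:
  assumes clos: "is_coherent_closure \<Omega> T S" and f: "bij_betw f \<Omega> \<Omega>'"
    and agree: "\<And>t x y u v. t \<in> T \<Longrightarrow> x \<in> \<Omega> \<Longrightarrow> y \<in> \<Omega> \<Longrightarrow> u \<in> \<Omega> \<Longrightarrow> v \<in> \<Omega> \<Longrightarrow>
      \<phi> (X.rel u v) = Y.rel (f x) (f y) \<Longrightarrow> (x, y) \<in> t \<longleftrightarrow> (u, v) \<in> t"
    and xy: "x \<in> \<Omega>" "y \<in> \<Omega>"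
  shows "\<phi> (X.rel x y) = Y.rel (f x) (f y)"
proof -
  have f_mem: "f x \<in> \<Omega>'" if "x \<in> \<Omega>" for x using f that bij_betwE by blast
  have f_inj: "x = y" if "x \<in> \<Omega>" "y \<in> \<Omega>" "f x = f y" for x y
    using f that unfolding bij_betw_def inj_on_def by blast
  define G where "G = {(X.rel x y, X.rel u v) |x y u v. x \<in> \<Omega> \<and> y \<in> \<Omega> \<and> u \<in> \<Omega> \<and> v \<in> \<Omega> \<and>
    \<phi> (X.rel u v) = Y.rel (f x) (f y)}"
  define H where "H = (G \<union> G\<inverse>)\<^sup>*"
  define E where "E = {((x, y), (u, v)) |x y u v. x \<in> \<Omega> \<and> y \<in> \<Omega> \<and> u \<in> \<Omega> \<and> v \<in> \<Omega> \<and>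
    (X.rel x y, X.rel u v) \<in> H}"
  have symH: "sym H" unfolding H_def by (rule sym_rtrancl) (auto intro: symI)
  have transH: "trans H" unfolding H_def by (rule trans_rtrancl)
  have equivE: "equiv (\<Omega> \<times> \<Omega>) E"
  proof (rule equivI)
    show "E \<subseteq> (\<Omega> \<times> \<Omega>) \<times> (\<Omega> \<times> \<Omega>)" unfolding E_def by blast
    show "refl_on (\<Omega> \<times> \<Omega>) E" unfolding E_def H_def refl_on_def by blast
    show "sym E" unfolding E_def using symH by (auto intro!: symI dest: symD)
    show "trans E" unfolding E_def using transH by (auto intro!: transI dest: transD)
  qed
  have symE: "sym E" using equivE unfolding equiv_def by blast
  define F where "F = (\<Omega> \<times> \<Omega>) // E"
  have partF: "partition_on (\<Omega> \<times> \<Omega>) F"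
    unfolding F_def by (rule partition_on_quotient[OF equivE])
  \<comment> \<open>\<open>good r\<close> says that \<open>f\<close> carries \<open>r\<close> onto
    the union of the \<open>\<phi>\<close>-images of the basis relations inside \<open>r\<close>.
    These relations are the unions of classes of \<open>E\<close>; working with \<open>good\<close>
    avoids handling chains of links.\<close>
  define good where "good r \<longleftrightarrow> union_of S r \<and> (\<forall>x\<in>\<Omega>. \<forall>y\<in>\<Omega>. \<forall>u\<in>\<Omega>. \<forall>v\<in>\<Omega>.
    \<phi> (X.rel u v) = Y.rel (f x) (f y) \<longrightarrow> ((x, y) \<in> r \<longleftrightarrow> (u, v) \<in> r))" for r
  have goodD: "(x, y) \<in> r \<longleftrightarrow> (u, v) \<in> r" if "good r" "x \<in> \<Omega>" "y \<in> \<Omega>" "u \<in> \<Omega>" "v \<in> \<Omega>"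
    "\<phi> (X.rel u v) = Y.rel (f x) (f y)" for r x y u v
    using that unfolding good_def by blast
  have good_step: "s \<subseteq> r \<longleftrightarrow> t \<subseteq> r" if st: "good r" "(s, t) \<in> G" for r s t
  proof -
    obtain x y u v where *: "s = X.rel x y" "t = X.rel u v" "x \<in> \<Omega>" "y \<in> \<Omega>" "u \<in> \<Omega>" "v \<in> \<Omega>"
        "\<phi> (X.rel u v) = Y.rel (f x) (f y)"
      using st(2) unfolding G_def by blast
    have un: "union_of S r" using st unfolding good_def by blast
    show ?thesis
      unfolding *(1,2) X.union_of_subset_iff[OF un *(3,4)] X.union_of_subset_iff[OF un *(5,6)]
      by (rule goodD[OF st(1) *(3-7)])
  qed
  have good_cluster: "s \<subseteq> r \<longleftrightarrow> t \<subseteq> r" if "(s, t) \<in> H" "good r" for r s t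
    using that(1) unfolding H_def
  proof (induction rule: rtrancl_induct)
    case (step t u)
    then show ?case using good_step[OF that(2)] by blast
  qed simp
  have good_E: "q \<in> r" if "good r" "(p, q) \<in> E" "p \<in> r" for p q r
  proof -
    obtain x y u v where *: "p = (x, y)" "q = (u, v)" "x \<in> \<Omega>" "y \<in> \<Omega>" "u \<in> \<Omega>" "v \<in> \<Omega>"
        "(X.rel x y, X.rel u v) \<in> H"
      using \<open>(p, q) \<in> E\<close> unfolding E_def by blast
    have un: "union_of S r" using that unfolding good_def by blast
    show ?thesis
      using good_cluster[OF *(7) that(1)] that(3)
      unfolding *(1,2) X.union_of_subset_iff[OF un *(3,4)] X.union_of_subset_iff[OF un *(5,6)] by blast
  qed
  have inE: "(p, q) \<in> E" if "s \<in> F" "p \<in> s" "q \<in> s" for p q s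
    using quotient_eq_iff[OF equivE] that unfolding F_def by blast
  have inF: "q \<in> s" if "s \<in> F" "p \<in> s" "(p, q) \<in> E" for p q s
    using in_quotient_imp_closed[OF equivE] that unfolding F_def by blast
  have good_union: "union_of F r" if "good r" for r
  proof -
    have "r \<subseteq> \<Omega> \<times> \<Omega>" using that unfolding good_def X.union_of_iff by blast
    then show ?thesis
      unfolding union_of_partition_iff[OF partF] using good_E[OF that] inE by blast
  qed
  have E_rel: "((x, y), (u, v)) \<in> E"
    if "x \<in> \<Omega>" "y \<in> \<Omega>" "u \<in> \<Omega>" "v \<in> \<Omega>" "(X.rel x y, X.rel u v) \<in> H" for x y u v
    unfolding E_def using that by blast
  have E_step: "((x, y), (u, v)) \<in> E"
    if "x \<in> \<Omega>" "y \<in> \<Omega>" "u \<in> \<Omega>" "v \<in> \<Omega>" "\<phi> (X.rel u v) = Y.rel (f x) (f y)" for x y u v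
  proof (rule E_rel[OF that(1-4)])
    have "(X.rel x y, X.rel u v) \<in> G" unfolding G_def using that by blast
    then show "(X.rel x y, X.rel u v) \<in> H" unfolding H_def by blast
  qed
  have goodF: "good r" if r: "r \<in> F" for r
    unfolding good_def X.union_of_iff
  proof (intro conjI ballI impI)
    show "r \<subseteq> \<Omega> \<times> \<Omega>" using partition_onD1[OF partF] r by blast
    fix x y u v assume *: "x \<in> \<Omega>" "y \<in> \<Omega>" "u \<in> \<Omega>" "v \<in> \<Omega>"
    {
      assume "X.rel x y = X.rel u v" and xy: "(x, y) \<in> r"
      then have "((x, y), (u, v)) \<in> E" by (intro E_rel *) (simp add: H_def)
      then show "(u, v) \<in> r" by (rule inF[OF r xy])
    next
      assume "\<phi> (X.rel u v) = Y.rel (f x) (f y)"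
      then have "((x, y), (u, v)) \<in> E" by (rule E_step[OF *])
      moreover from this have "((u, v), (x, y)) \<in> E" by (rule symD[OF symE])
      ultimately show "(x, y) \<in> r \<longleftrightarrow> (u, v) \<in> r" using inF[OF r] by blast
    }
  qed
  \<comment> \<open>The count at \<open>(x, y)\<close> is carried by \<open>f\<close> to a count at
    \<open>(f x, f y)\<close>, where it is a sum of intersection numbers; \<open>\<phi>\<close>
    identifies that sum with the one for \<open>(u, v)\<close>.\<close>
  have count: "card (r `` {x} \<inter> s\<inverse> `` {y}) = card (r `` {u} \<inter> s\<inverse> `` {v})"
    if r: "good r" and s: "good s" and *: "x \<in> \<Omega>" "y \<in> \<Omega>" "u \<in> \<Omega>" "v \<in> \<Omega>"
      "\<phi> (X.rel u v) = Y.rel (f x) (f y)" for r s x y u v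
  proof -
    define U V where UV: "U = {b \<in> S. b \<subseteq> r}" "V = {b \<in> S. b \<subseteq> s}"
    have ur: "union_of S r" and us: "union_of S s" using r s unfolding good_def by auto
    have sub: "U \<subseteq> S" "V \<subseteq> S" "\<phi> ` U \<subseteq> S'" "\<phi> ` V \<subseteq> S'" unfolding UV using iso_mem by auto
    have memU: "X.rel a b \<in> U \<longleftrightarrow> (a, b) \<in> r" if "a \<in> \<Omega>" "b \<in> \<Omega>" for a b
      unfolding UV using X.union_of_subset_iff[OF ur that] X.rel_mem[OF that] by simp
    have memV: "X.rel a b \<in> V \<longleftrightarrow> (a, b) \<in> s" if "a \<in> \<Omega>" "b \<in> \<Omega>" for a b
      unfolding UV using X.union_of_subset_iff[OF us that] X.rel_mem[OF that] by simp
    have \<phi>_image: "Y.rel (f a) (f b) \<in> \<phi> ` W \<longleftrightarrow> (a, b) \<in> q"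
      if ab: "a \<in> \<Omega>" "b \<in> \<Omega>" and q: "good q" and W: "W \<subseteq> S"
        "\<And>a b. a \<in> \<Omega> \<Longrightarrow> b \<in> \<Omega> \<Longrightarrow> X.rel a b \<in> W \<longleftrightarrow> (a, b) \<in> q" for a b q W
    proof -
      obtain c d where cd: "c \<in> \<Omega>" "d \<in> \<Omega>" "\<phi> (X.rel c d) = Y.rel (f a) (f b)"
        by (rule iso_surjE[OF f_mem[OF ab(1)] f_mem[OF ab(2)]])
      have "Y.rel (f a) (f b) \<in> \<phi> ` W \<longleftrightarrow> X.rel c d \<in> W"
        unfolding cd(3)[symmetric] using iso_inj X.rel_mem[OF cd(1,2)] W(1) by blast
      then show ?thesis using W(2)[OF cd(1,2)] goodD[OF q ab cd] by simp
    qed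
    have inside: "q `` {a} \<inter> q'\<inverse> `` {b} = {z \<in> \<Omega>. (a, z) \<in> q \<and> (z, b) \<in> q'}" if "good q" for q q' a b
      using that unfolding good_def X.union_of_iff by blast
    have "card (r `` {x} \<inter> s\<inverse> `` {y}) = card {z \<in> \<Omega>. (x, z) \<in> r \<and> (z, y) \<in> s}"
      by (simp only: inside[OF r])
    also have "\<dots> = card (f ` {z \<in> \<Omega>. (x, z) \<in> r \<and> (z, y) \<in> s})"
      by (rule card_image[symmetric]) (use f_inj in \<open>auto intro!: inj_onI\<close>)
    also have "f ` {z \<in> \<Omega>. (x, z) \<in> r \<and> (z, y) \<in> s} =
        {z' \<in> \<Omega>'. Y.rel (f x) z' \<in> \<phi> ` U \<and> Y.rel z' (f y) \<in> \<phi> ` V}"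
      using \<phi>_image[OF *(1) _ r sub(1) memU] \<phi>_image[OF _ *(2) s sub(2) memV] f_mem
        bij_betw_imp_surj_on[OF f] by (intro set_eqI iffI) (blast, blast)
    also have "card \<dots> = (\<Sum>(a, b)\<in>\<phi> ` U \<times> \<phi> ` V. intersection_number a b (Y.rel (f x) (f y)))"
      by (rule Y.card_union_sum[OF sub(3,4) f_mem[OF *(1)] f_mem[OF *(2)]])
    also have "\<dots> = (\<Sum>(a, b)\<in>U \<times> V. intersection_number a b (X.rel u v))"
    proof -
      have inj: "inj_on (map_prod \<phi> \<phi>) (U \<times> V)"
        using iso_inj sub(1,2) by (intro map_prod_inj_on inj_onI) blast+
      have "\<phi> ` U \<times> \<phi> ` V = map_prod \<phi> \<phi> ` (U \<times> V)" by auto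
      then have "(\<Sum>(a, b)\<in>\<phi> ` U \<times> \<phi> ` V. intersection_number a b (Y.rel (f x) (f y))) =
          (\<Sum>(a, b)\<in>U \<times> V. intersection_number (\<phi> a) (\<phi> b) (\<phi> (X.rel u v)))"
        by (simp add: sum.reindex[OF inj] case_prod_beta *(5))
      also have "\<dots> = (\<Sum>(a, b)\<in>U \<times> V. intersection_number a b (X.rel u v))"
        by (rule sum.cong[OF refl]) (use iso_number[OF subsetD[OF sub(1)] subsetD[OF sub(2)] X.rel_mem[OF *(3,4)]] in auto)
      finally show ?thesis .
    qed
    also have "\<dots> = card {z \<in> \<Omega>. X.rel u z \<in> U \<and> X.rel z v \<in> V}"
      by (rule X.card_union_sum[OF sub(1,2) *(3,4), symmetric])
    also have "{z \<in> \<Omega>. X.rel u z \<in> U \<and> X.rel z v \<in> V} = {z \<in> \<Omega>. (u, z) \<in> r \<and> (z, v) \<in> s}"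
      using memU[OF *(3)] memV[OF _ *(4)] by blast
    also have "card \<dots> = card (r `` {u} \<inter> s\<inverse> `` {v})"
      by (simp only: inside[OF r])
    finally show ?thesis .
  qed
  have ccF: "coherent_configuration \<Omega> F"
  proof
    show "finite \<Omega>" by (rule X.finite_points)
    show "partition_on (\<Omega> \<times> \<Omega>) F" by (rule partF)
    have "x = y \<longleftrightarrow> u = v" if "x \<in> \<Omega>" "y \<in> \<Omega>" "u \<in> \<Omega>" "v \<in> \<Omega>" "\<phi> (X.rel u v) = Y.rel (f x) (f y)" for x y u v
    proof
      assume "x = y" then show "u = v" using iso_diag'[of u v "f x"] that f_mem by simp
    next
      assume "u = v" then show "x = y" using iso_diag[of u "f x" "f y"] that f_mem f_inj by blast
    qed
    then have "good (Id_on \<Omega>)" unfolding good_def using X.diagonal by auto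
    then show "union_of F (Id_on \<Omega>)" by (rule good_union)
  next
    fix s assume s: "s \<in> F"
    have good_conv: "good (s\<inverse>)" if s: "s \<in> F" for s
      unfolding good_def X.union_of_iff
    proof (intro conjI ballI impI)
      have gs: "good s" by (rule goodF[OF s])
      then have us: "union_of S s" unfolding good_def by blast
      then show "s\<inverse> \<subseteq> \<Omega> \<times> \<Omega>" unfolding X.union_of_iff by blast
      fix x y u v assume *: "x \<in> \<Omega>" "y \<in> \<Omega>" "u \<in> \<Omega>" "v \<in> \<Omega>"
      {
        assume xy: "X.rel x y = X.rel u v" "(x, y) \<in> s\<inverse>"
        have "(v, u) \<in> s"
          by (rule X.union_of_imp[OF us X.rel_swap[OF xy(1) *] *(2,1,4,3)]) (use xy(2) in blast)
        then show "(u, v) \<in> s\<inverse>" by blast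
      next
        assume xy: "\<phi> (X.rel u v) = Y.rel (f x) (f y)"
        have "\<phi> (X.rel v u) = Y.rel (f y) (f x)"
          by (rule iso_swap[OF *(3,4) f_mem[OF *(1)] f_mem[OF *(2)] xy])
        then show "(x, y) \<in> s\<inverse> \<longleftrightarrow> (u, v) \<in> s\<inverse>"
          using goodD[OF gs *(2,1,4,3)] by blast
      }
    qed
    obtain x y where xy: "(x, y) \<in> \<Omega> \<times> \<Omega>" "s = E `` {(x, y)}"
      using s unfolding F_def by (auto elim: quotientE)
    define c where "c = E `` {(y, x)}"
    have yx: "(y, x) \<in> \<Omega> \<times> \<Omega>" using xy by blast
    have c: "c \<in> F" unfolding c_def F_def by (rule quotientI[OF yx])
    have "(x, y) \<in> s" using equiv_class_self[OF equivE xy(1)] xy(2) by simp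
    then have "(y, x) \<in> s\<inverse>" by blast
    then have "c \<subseteq> s\<inverse>" unfolding c_def using good_E[OF good_conv[OF s]] by blast
    moreover have "(x, y) \<in> c\<inverse>" using equiv_class_self[OF equivE yx] unfolding c_def by blast
    then have "s \<subseteq> c\<inverse>" unfolding xy(2) using good_E[OF good_conv[OF c]] by blast
    ultimately have "s\<inverse> = c" by blast
    then show "s\<inverse> \<in> F" using c by simp
  next
    fix r s t assume rst: "r \<in> F" "s \<in> F" "t \<in> F"
    let ?g = "\<lambda>(x, y). card (r `` {x} \<inter> s\<inverse> `` {y})"
    have gr: "good r" and gs: "good s" using goodF rst by auto
    then have ur: "union_of S r" and us: "union_of S s" unfolding good_def by auto
    have "t \<noteq> {}" using rst(3) partition_onD3[OF partF] by auto
    then obtain p where p: "p \<in> t" by blast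
    \<comment> \<open>For (C3), the pairs with the same count as \<open>p\<close> form a good
      relation, which therefore contains the whole class \<open>t\<close>.\<close>
    let ?P = "{q \<in> \<Omega> \<times> \<Omega>. ?g q = ?g p}"
    have "good ?P"
      unfolding good_def X.union_of_iff
    proof (intro conjI ballI impI)
      fix x y u v assume *: "x \<in> \<Omega>" "y \<in> \<Omega>" "u \<in> \<Omega>" "v \<in> \<Omega>"
      {
        assume xy: "X.rel x y = X.rel u v" and g: "(x, y) \<in> ?P"
        have uv: "(u, v) \<in> X.rel x y" unfolding xy by (rule X.in_rel[OF *(3,4)])
        have "card (r `` {x} \<inter> s\<inverse> `` {y}) = card (r `` {u} \<inter> s\<inverse> `` {v})"
          by (rule X.card_union_constant[OF ur us X.rel_mem[OF *(1,2)] X.in_rel[OF *(1,2)] uv])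
        then show "(u, v) \<in> ?P" using g * by simp
      next
        assume "\<phi> (X.rel u v) = Y.rel (f x) (f y)"
        from count[OF gr gs * this] show "(x, y) \<in> ?P \<longleftrightarrow> (u, v) \<in> ?P" using * by simp
      }
    qed blast
    moreover have "p \<in> ?P" using p rst(3) partition_onD1[OF partF] by blast
    ultimately have "q \<in> ?P" if "q \<in> t" for q using good_E inE[OF rst(3) p that] by blast
    then show "\<exists>c. \<forall>(\<alpha>, \<beta>)\<in>t. card (r `` {\<alpha>} \<inter> s\<inverse> `` {\<beta>}) = c"
      by (intro exI[of _ "?g p"]) auto
  qed
  have "union_of F t" if "t \<in> T" for t
    by (rule good_union) (use clos that agree in \<open>auto simp: good_def is_coherent_closure_def\<close>)
  \<comment> \<open>\<open>F\<close> was obtained from \<open>S\<close> by merging. Minimality of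
    \<open>S\<close> gives the other direction, so the linked pairs \<open>(x, y)\<close> and
    \<open>(u, v)\<close> lie in one basis relation of \<open>S\<close>.\<close>
  then have "conf_le S F" using clos ccF unfolding is_coherent_closure_def by blast
  then have un: "union_of F (X.rel x y)" using X.rel_mem[OF xy] unfolding conf_le_def by blast
  obtain u v where uv: "u \<in> \<Omega>" "v \<in> \<Omega>" "\<phi> (X.rel u v) = Y.rel (f x) (f y)"
    by (rule iso_surjE[OF f_mem[OF xy(1)] f_mem[OF xy(2)]])
  have "((x, y), (u, v)) \<in> E" by (rule E_step[OF xy uv])
  moreover have "(x, y) \<in> \<Omega> \<times> \<Omega>" using xy by simp
  ultimately have "\<exists>s\<in>F. (x, y) \<in> s \<and> (u, v) \<in> s"
    using equiv_class_self[OF equivE] unfolding F_def by (blast intro: quotientI)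
  then have "(u, v) \<in> X.rel x y"
    using un X.in_rel[OF xy] unfolding union_of_partition_iff[OF partF] by blast
  then show ?thesis using X.rel_eq[OF X.rel_mem[OF xy]] uv(3) by simp
qed

lemma isomorphism_of_bijection:
  assumes f: "bij_betw f \<Omega> \<Omega>'"
    and agree: "\<And>x y. x \<in> \<Omega> \<Longrightarrow> y \<in> \<Omega> \<Longrightarrow> \<phi> (X.rel x y) = Y.rel (f x) (f y)"
  shows "combinatorial_isomorphism \<Omega> S \<Omega>' S' f \<and> (\<forall>s\<in>S. \<phi> s = map_prod f f ` s)"
proof -
  have f_mem: "f x \<in> \<Omega>'" if "x \<in> \<Omega>" for x using f that bij_betwE by blast
  have eq: "\<phi> s = map_prod f f ` s" if s: "s \<in> S" for s
  proof (intro set_eqI iffI)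
    fix p assume p: "p \<in> \<phi> s"
    obtain x' y' where p': "p = (x', y')" by (cases p)
    then have "x' \<in> \<Omega>'" "y' \<in> \<Omega>'" using Y.block_in[OF iso_mem[OF s]] p by blast+
    then obtain x y where xy: "x \<in> \<Omega>" "y \<in> \<Omega>" "x' = f x" "y' = f y"
      using bij_betw_imp_surj_on[OF f] by blast
    have "\<phi> (X.rel x y) = \<phi> s"
      unfolding agree[OF xy(1,2)] using Y.rel_eq[OF iso_mem[OF s]] p p' xy by blast
    then have "X.rel x y = s" by (rule iso_inj[OF X.rel_mem[OF xy(1,2)] s])
    then have "(x, y) \<in> s" using X.in_rel[OF xy(1,2)] by simp
    then show "p \<in> map_prod f f ` s" unfolding p' xy(3,4) by (auto intro: rev_image_eqI)
  next
    fix p assume "p \<in> map_prod f f ` s"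
    then obtain x y where xy: "(x, y) \<in> s" "p = (f x, f y)" by auto
    have m: "x \<in> \<Omega>" "y \<in> \<Omega>" using X.block_in[OF s xy(1)] by auto
    have "X.rel x y = s" by (rule X.rel_eq[OF s xy(1)])
    then show "p \<in> \<phi> s" using Y.in_rel[OF f_mem[OF m(1)] f_mem[OF m(2)]] agree[OF m] xy(2) by simp
  qed
  then have "map_prod f f ` s \<in> S'" if "s \<in> S" for s using iso_mem[OF that] that by simp
  then show ?thesis unfolding combinatorial_isomorphism_def using f eq by blast
qed

end

section \<open>Biregular bipartite graphs without long induced cycles\<close>

lemma rtrancl_first_hit:
  assumes "(x, y) \<in> (r \<inter> Q \<times> Q)\<^sup>*" "x \<notin> P" "y \<in> P"
  obtains p q where "(x, p) \<in> (r \<inter> (Q - P) \<times> (Q - P))\<^sup>*" "(p, q) \<in> r" "q \<in> Q" "q \<in> P" "(x, q) \<in> (r \<inter> Q \<times> Q)\<^sup>*"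
proof -
  have "y \<notin> P \<and> (x, y) \<in> (r \<inter> (Q - P) \<times> (Q - P))\<^sup>* \<or>
    (\<exists>p q. (x, p) \<in> (r \<inter> (Q - P) \<times> (Q - P))\<^sup>* \<and> (p, q) \<in> r \<and> q \<in> Q \<and> q \<in> P \<and> (x, q) \<in> (r \<inter> Q \<times> Q)\<^sup>*)"
    using assms(1)
  proof (induction rule: rtrancl_induct)
    case base
    then show ?case using assms(2) by blast
  next
    case (step y z)
    have xz: "(x, z) \<in> (r \<inter> Q \<times> Q)\<^sup>*" using step.hyps by (rule rtrancl_into_rtrancl)
    from step.IH show ?case
    proof
      assume y: "y \<notin> P \<and> (x, y) \<in> (r \<inter> (Q - P) \<times> (Q - P))\<^sup>*"
      show ?thesis
      proof (cases "z \<in> P")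
        case True
        then show ?thesis using y step.hyps(2) xz by blast
      next
        case False
        then have "(y, z) \<in> r \<inter> (Q - P) \<times> (Q - P)" using y step.hyps(2) by blast
        then show ?thesis using y False by (blast intro: rtrancl_into_rtrancl)
      qed
    qed blast
  qed
  then show thesis using assms(3) that by blast
qed

lemma rtrancl_walk:
  assumes "(x, y) \<in> r\<^sup>*"
  obtains f n where "f 0 = x" "f n = y" "\<And>i. i < n \<Longrightarrow> (f i, f (Suc i)) \<in> r"
  using assms rtrancl_power relpow_fun_conv by metis

text \<open>\<open>no_cycle\<close> is the negation of an induced cycle, stated for an arbitrary
  enumeration \<open>f\<close>. The bipartition is a colouring without a vertex set, so the two
  sides can be interchanged by recolouring.\<close>

locale long_cycle_free =
  fixes D :: "'a rel" and col :: "'a \<Rightarrow> bool"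
  assumes sym: "(x, y) \<in> D \<Longrightarrow> (y, x) \<in> D"
    and col: "(x, y) \<in> D \<Longrightarrow> col x \<noteq> col y"
    and no_cycle: "n \<ge> 6 \<Longrightarrow> inj_on f {..<n} \<Longrightarrow>
      \<exists>i<n. \<exists>j<n. ((f i, f j) \<in> D) \<noteq> (j = Suc i mod n \<or> i = Suc j mod n)"
begin

text \<open>Removes the modular arithmetic: an induced cycle is checked on index pairs
  \<open>i < j\<close> only, with its closing edge listed separately.\<close>

lemma no_cycle_upto_symmetry:
  assumes n: "n \<ge> 6"
    and dist: "\<And>i j. i < j \<Longrightarrow> j < n \<Longrightarrow> f i \<noteq> f j"
    and adj: "\<And>i. Suc i < n \<Longrightarrow> (f i, f (Suc i)) \<in> D"
    and closing: "(f 0, f (n - 1)) \<in> D"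
    and chordless: "\<And>i j. Suc i < j \<Longrightarrow> j < n \<Longrightarrow> \<not> (i = 0 \<and> j = n - 1) \<Longrightarrow> (f i, f j) \<notin> D"
  shows False
proof -
  have inj: "inj_on f {..<n}"
    by (rule inj_onI) (metis dist lessThan_iff linorder_neqE_nat)
  have irr: "(f i, f i) \<notin> D" for i using col by blast
  have le: "(f i, f j) \<in> D \<longleftrightarrow> (j = Suc i mod n \<or> i = Suc j mod n)" if ij: "i < j" "j < n" for i j
  proof -
    have si: "Suc i mod n = Suc i" using that by simp
    have sj: "Suc j mod n = (if j = n - 1 then 0 else Suc j)" using that n by auto
    consider "j = Suc i" | "i = 0" "j = n - 1" | "Suc i < j" "\<not> (i = 0 \<and> j = n - 1)"
      using ij by linarith
    then show ?thesis
    proof cases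
      case 1 then show ?thesis using adj that by simp
    next
      case 2 then show ?thesis using closing sj by simp
    next
      case 3 then show ?thesis using chordless[OF 3(1) that(2) 3(2)] that unfolding si sj by auto
    qed
  qed
  have self: "\<not> (i = Suc i mod n)" if "i < n" for i using that n by (cases "Suc i = n") auto
  obtain i j where ij: "i < n" "j < n" "((f i, f j) \<in> D) \<noteq> (j = Suc i mod n \<or> i = Suc j mod n)"
    using no_cycle[OF n inj] by blast
  consider "i < j" | "i = j" | "j < i" by linarith
  then show False
  proof cases
    case 1 then show False using le ij by blast
  next
    case 2 then show False using ij irr self by auto
  next
    case 3 then show False using le[OF 3 ij(1)] ij(3) sym by blast
  qed
qed

text \<open>A shortest walk from \<open>s\<close> to \<open>t\<close> with interior in
  \<open>Q\<close> is chordless, and \<open>a\<close> sees only its ends, so together with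
  \<open>a\<close> it bounds an induced cycle. Its length is even, hence 2 or at least 4; in the
  latter case the cycle has at least 6 vertices.\<close>

lemma common_neighbour:
  assumes as: "(a, s) \<in> D" and at: "(a, t) \<in> D"
    and Q: "\<And>q. q \<in> Q \<Longrightarrow> (a, q) \<notin> D" "a \<notin> Q"
    and xy: "(x, y) \<in> (D \<inter> Q \<times> Q)\<^sup>*" "x \<in> Q" and sx: "(s, x) \<in> D" and ty: "(t, y) \<in> D"
  obtains z where "z \<in> Q" "(s, z) \<in> D" "(t, z) \<in> D"
proof (cases "s = t")
  case True
  then show thesis using that xy sx by blast
next
  case False
  define walk where "walk n f \<longleftrightarrow> f 0 = s \<and> f n = t \<and> (\<forall>i<n. (f i, f (Suc i)) \<in> D) \<and>
    (\<forall>i<n. 0 < i \<longrightarrow> f i \<in> Q)" for n and f :: "nat \<Rightarrow> 'a"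
  have "\<exists>n f. walk n f"
  proof -
    obtain g m where g: "g 0 = x" "g m = y" "\<And>i. i < m \<Longrightarrow> (g i, g (Suc i)) \<in> D \<inter> Q \<times> Q"
      using rtrancl_walk[OF xy(1)] by blast
    have gQ: "g i \<in> Q" if "i \<le> m" for i
      using that g xy(2) by (cases i) auto
    \<comment> \<open>The walk \<open>g\<close> of length \<open>m\<close>, shifted by one to make
      room for \<open>s\<close> and \<open>t\<close> at the ends.\<close>
    define f where "f i = (if i = 0 then s else if i \<le> Suc m then g (i - 1) else t)" for i
    have "(f i, f (Suc i)) \<in> D" if "i < m + 2" for i
    proof -
      consider "i = 0" | "i = Suc m" | k where "i = Suc k" "k < m" using \<open>i < m + 2\<close>
        by (cases i) force+
      then show ?thesis using sx sym[OF ty] g unfolding f_def by cases auto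
    qed
    then have "walk (m + 2) f" unfolding walk_def using gQ by (auto simp: f_def)
    then show ?thesis by blast
  qed
  define n where "n = (LEAST n. \<exists>f. walk n f)"
  have "\<exists>f. walk n f" unfolding n_def by (rule LeastI_ex) fact
  then obtain f where f: "walk n f" by blast
  have minimal: "\<not> walk m g" if "m < n" for m g
    using not_less_Least that unfolding n_def by blast
  have f0: "f 0 = s" "f n = t" and fD: "\<And>i. i < n \<Longrightarrow> (f i, f (Suc i)) \<in> D"
    and fQ: "\<And>i. i < n \<Longrightarrow> 0 < i \<Longrightarrow> f i \<in> Q"
    using f unfolding walk_def by auto
  have dist: "f i \<noteq> f j" if "i < j" "j \<le> n" for i j
  proof
    assume eq: "f i = f j"
    \<comment> \<open>A repeated vertex would allow the closed part between positions
      \<open>i\<close> and \<open>j\<close> to be cut out.\<close>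
    define g where "g k = (if k \<le> i then f k else f (k + (j - i)))" for k
    have "walk (n - (j - i)) g"
      unfolding walk_def
    proof (intro conjI allI impI)
      show "g 0 = s" by (simp add: g_def f0)
      show "g (n - (j - i)) = t"
        using that eq f0 by (cases "j = n") (auto simp: g_def)
      fix k assume k: "k < n - (j - i)"
      show "(g k, g (Suc k)) \<in> D"
        using k fD[of k] fD[of "k + (j - i)"] that eq
        by (cases "k = i") (auto simp: g_def)
      assume "0 < k"
      then show "g k \<in> Q" using k fQ that by (auto simp: g_def)
    qed
    moreover have "n - (j - i) < n" using that by simp
    ultimately show False using minimal by blast
  qed
  have chord: "(f i, f j) \<notin> D" if "Suc i < j" "j \<le> n" for i j
  proof
    assume eq: "(f i, f j) \<in> D"
    \<comment> \<open>A chord would allow the positions strictly between \<open>i\<close> and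
      \<open>j\<close> to be skipped.\<close>
    define g where "g k = (if k \<le> i then f k else f (k + (j - Suc i)))" for k
    have "walk (n - (j - Suc i)) g"
      unfolding walk_def
    proof (intro conjI allI impI)
      show "g 0 = s" by (simp add: g_def f0)
      show "g (n - (j - Suc i)) = t"
        using that f0 by (auto simp: g_def)
      fix k assume k: "k < n - (j - Suc i)"
      show "(g k, g (Suc k)) \<in> D"
        using k fD[of k] fD[of "k + (j - Suc i)"] that eq
        by (cases "k = i") (auto simp: g_def)
      assume "0 < k"
      then show "g k \<in> Q" using k fQ that by (auto simp: g_def)
    qed
    moreover have "n - (j - Suc i) < n" using that by simp
    ultimately show False using minimal by blast
  qed
  have coli: "col (f i) \<longleftrightarrow> (col s \<longleftrightarrow> even i)" if "i \<le> n" for i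
    using that
  proof (induction i)
    case 0 then show ?case by (simp add: f0)
  next
    case (Suc i)
    then show ?case using col[OF fD[of i]] by auto
  qed
  have "col s = col t" using col[OF as] col[OF at] by auto
  then have "even n" using coli[of n] f0 by auto
  moreover have "n \<noteq> 0" using f0 False by metis
  ultimately consider "n = 2" | "n \<ge> 4" by (cases "n = 3") (fastforce, force)
  then show thesis
  proof cases
    case 1
    then show thesis using that[of "f 1"] fD[of 0] fD[of 1] fQ[of 1] f0 sym by (simp add: numeral_2_eq_2)
  next
    case 2
    \<comment> \<open>The walk has \<open>n + 1\<close> vertices; appending \<open>a\<close> closes
      it to a cycle of length \<open>n + 2\<close>.\<close>
    define g where "g = f(Suc n := a)"
    have anf: "a \<noteq> f i" if "i \<le> n" for i
      using that Q(2) fQ[of i] f0 col[OF as] col[OF at] by (cases "i = 0 \<or> i = n") auto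
    have aadj: "(f i, a) \<notin> D" if "i < n" "0 < i" for i
      using Q(1) fQ[OF that] sym by blast
    have False
    proof (rule no_cycle_upto_symmetry[of "n + 2" g])
      show "n + 2 \<ge> 6" using 2 by simp
      fix i j :: nat assume "i < j" "j < n + 2"
      then show "g i \<noteq> g j" using dist[of i j] anf[of i] unfolding g_def
        by (cases "j = Suc n") auto
    next
      fix i assume "Suc i < n + 2"
      then show "(g i, g (Suc i)) \<in> D" using fD[of i] sym[OF at] f0 unfolding g_def
        by (cases "i = n") auto
    next
      show "(g 0, g (n + 2 - 1)) \<in> D" using sym[OF as] f0 by (simp add: g_def)
    next
      fix i j :: nat assume "Suc i < j" "j < n + 2" "\<not> (i = 0 \<and> j = n + 2 - 1)"
      then show "(g i, g j) \<notin> D" using chord[of i j] aadj[of i] unfolding g_def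
        by (cases "j = Suc n") auto
    qed
    then show thesis ..
  qed
qed

text \<open>A bipartite form of Dirac's separator argument: if \<open>C\<close> is a component of the graph minus the
  neighbourhood of \<open>a\<close>, and \<open>S\<close> is the part of that neighbourhood attached to \<open>C\<close>, then a vertex
  \<open>c\<close> of \<open>C\<close> with maximally many neighbours in \<open>S\<close> is adjacent to all of \<open>S\<close>. Either \<open>c\<close> leaves a
  smaller component inside \<open>C\<close>, or counting degrees contradicts regularity.\<close>

lemma separator_nonempty_False:
  fixes A B :: "'a set"
  assumes finA: "finite A" and finB: "finite B"
    and AB: "\<And>x. x \<in> A \<Longrightarrow> col x" "\<And>x. x \<in> B \<Longrightarrow> \<not> col x"
    and degA: "\<And>x y. x \<in> A \<Longrightarrow> y \<in> A \<Longrightarrow> card (D `` {x} \<inter> B) = card (D `` {y} \<inter> B)"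
    and degB: "\<And>x y. x \<in> B \<Longrightarrow> y \<in> B \<Longrightarrow> card (D `` {x} \<inter> A) = card (D `` {y} \<inter> A)"
    and a: "a \<in> A" and v: "v \<in> B" "(a, v) \<notin> D"
    and Q: "Q = {q \<in> A \<union> B. (a, q) \<notin> D}" and C: "C = {w. (v, w) \<in> (D \<inter> Q \<times> Q)\<^sup>*}"
    and s0: "s0 \<in> B" "(a, s0) \<in> D" "c0 \<in> C" "(s0, c0) \<in> D"
  shows False
  using a v Q C s0
proof (induction "card C" arbitrary: C Q a v s0 c0 rule: less_induct)
  case (less C Q a v s0 c0)
  note C = less.prems(5) and Q = less.prems(4)
  have vQ: "v \<in> Q" using less.prems by auto
  have CQ: "C \<subseteq> Q"
  proof
    fix w assume "w \<in> C"
    then show "w \<in> Q" using vQ unfolding C by (auto elim: rtranclE)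
  qed
  have finC: "finite C" using CQ finA finB unfolding Q by (auto intro: finite_subset)
  have symQ: "(x, y) \<in> (D \<inter> P \<times> P)\<^sup>* \<Longrightarrow> (y, x) \<in> (D \<inter> P \<times> P)\<^sup>*" for P x y
    by (rule symD[OF sym_rtrancl]) (auto intro: symI sym)
  have bip: "x \<in> A" if "(s, x) \<in> D" "s \<in> B" "x \<in> A \<union> B" for s x
    using that AB col by blast
  have bip': "x \<in> B" if "(s, x) \<in> D" "s \<in> A" "x \<in> A \<union> B" for s x
    using that AB col by blast
  have vC: "v \<in> C" unfolding C by simp
  have step: "w' \<in> C" if "w \<in> C" "(w, w') \<in> D" "w' \<in> Q" for w w'
  proof -
    have "(w, w') \<in> D \<inter> Q \<times> Q" using that CQ by blast
    then show ?thesis using that(1) unfolding C by (auto intro: rtrancl_into_rtrancl)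
  qed
  have aC: "a \<notin> C"
  proof
    assume "a \<in> C"
    moreover have "v \<noteq> a" using less.prems AB by blast
    ultimately obtain p where "(p, a) \<in> D" "p \<in> Q" unfolding C by (auto elim: rtranclE)
    then show False using sym unfolding Q by blast
  qed
  define S where "S = {s \<in> B. (a, s) \<in> D \<and> (\<exists>c\<in>C. (s, c) \<in> D)}"
  have finS: "finite S" unfolding S_def using finB by simp
  have s0S: "s0 \<in> S" using less.prems unfolding S_def by blast
  have c0A: "c0 \<in> C \<inter> A" using less.prems bip[of s0 c0] CQ unfolding Q by blast
  define m where "m c = card (D `` {c} \<inter> S)" for c
  have "\<exists>c. c \<in> C \<inter> A \<and> (\<forall>y. y \<in> C \<inter> A \<longrightarrow> m y \<le> m c)"
  proof (rule Lattices_Big.ex_has_greatest_nat[of "\<lambda>c. c \<in> C \<inter> A" c0 m "Suc (card S)"])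
    show "c0 \<in> C \<inter> A" by fact
    show "\<forall>y. y \<in> C \<inter> A \<longrightarrow> m y < Suc (card S)"
      unfolding m_def using finS by (auto simp: less_Suc_eq_le intro: card_mono)
  qed
  then obtain c where c: "c \<in> C" "c \<in> A" and cmax: "\<And>y. y \<in> C \<Longrightarrow> y \<in> A \<Longrightarrow> m y \<le> m c"
    by blast
  have Sc: "(c, s) \<in> D" if s: "s \<in> S" for s
  proof (rule ccontr)
    assume cs: "(c, s) \<notin> D"
    obtain e where e: "e \<in> C" "(s, e) \<in> D" using s unfolding S_def by blast
    have ce: "(c, e) \<in> (D \<inter> Q \<times> Q)\<^sup>*"
      using symQ[of v c Q] c e unfolding C by (auto intro: rtrancl_trans)
    obtain p q where pq: "(c, p) \<in> (D \<inter> (Q - D `` {s}) \<times> (Q - D `` {s}))\<^sup>*" "(p, q) \<in> D" "q \<in> Q"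
        "q \<in> D `` {s}" "(c, q) \<in> (D \<inter> Q \<times> Q)\<^sup>*"
      using rtrancl_first_hit[OF ce, of "D `` {s}"] cs e sym by blast
    have qC: "q \<in> C" using c pq(5) unfolding C by (auto intro: rtrancl_trans)
    have qA: "q \<in> A" using bip[of s q] pq s qC CQ unfolding S_def Q by blast
    \<comment> \<open>\<open>q\<close> is the first neighbour of \<open>s\<close> on a path from
      \<open>c\<close>, and the only neighbour of \<open>s\<close> in \<open>P\<close>. A common
      neighbour of \<open>s\<close> and \<open>t\<close> in \<open>P\<close> must be
      \<open>q\<close>, so \<open>q\<close> inherits all neighbours of \<open>c\<close> in
      \<open>S\<close> and has \<open>s\<close> in addition, against the choice of
      \<open>c\<close>.\<close>
    define P where "P = insert q (Q - D `` {s})"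
    have cP: "c \<in> P" using c CQ cs sym unfolding P_def by blast
    have "(c, p) \<in> (D \<inter> P \<times> P)\<^sup>*" using pq(1) unfolding P_def
      by (rule rtrancl_mono[THEN subsetD, rotated]) blast
    moreover have "p \<in> P" using cP pq(1) unfolding P_def by (auto elim: rtranclE)
    then have "(p, q) \<in> D \<inter> P \<times> P" using pq(2) unfolding P_def by blast
    ultimately have "(c, q) \<in> (D \<inter> P \<times> P)\<^sup>*" by (rule rtrancl_into_rtrancl)
    then have qc: "(q, c) \<in> (D \<inter> P \<times> P)\<^sup>*" by (rule symQ)
    have "(q, t) \<in> D" if t: "t \<in> S" "(c, t) \<in> D" for t
    proof -
      have "(a, s) \<in> D" "(a, t) \<in> D" using s t unfolding S_def by auto
      moreover have "(a, w) \<notin> D" if "w \<in> P" for w using that pq(3) unfolding P_def Q by blast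
      moreover have "a \<notin> P" using aC qC c sym s  unfolding P_def S_def by blast
      moreover have "q \<in> P" unfolding P_def by simp
      moreover have "(s, q) \<in> D" using pq by blast
      ultimately obtain z where "z \<in> P" "(s, z) \<in> D" "(t, z) \<in> D"
        using common_neighbour[of a s t P q c] qc sym[OF t(2)] by blast
      then show ?thesis using sym unfolding P_def by blast
    qed
    then have "insert s (D `` {c} \<inter> S) \<subseteq> D `` {q} \<inter> S" using s pq sym by blast
    moreover have "s \<notin> D `` {c} \<inter> S" using cs by blast
    ultimately have "m c < m q" unfolding m_def
      using finS by (intro psubset_card_mono) auto
    then show False using cmax[OF qC qA] by simp
  qed
  show False
  proof (cases "\<exists>w. w \<in> C \<inter> B \<and> (c, w) \<notin> D")
    case True
    then obtain w where w: "w \<in> C" "w \<in> B" "(c, w) \<notin> D" by blast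
    \<comment> \<open>The situation recurs with \<open>c\<close>, \<open>w\<close> in place of
      \<open>a\<close>, \<open>v\<close>. A walk that avoids the neighbours of \<open>c\<close>
      cannot leave \<open>C\<close>, since it would have to do so through \<open>S\<close>, which is
      adjacent to \<open>c\<close>. As \<open>c\<close> itself is not reached, the new component is
      strictly smaller.\<close>
    define Q' where "Q' = {q \<in> A \<union> B. (c, q) \<notin> D}"
    define C' where "C' = {u. (w, u) \<in> (D \<inter> Q' \<times> Q')\<^sup>*}"
    have sub: "u \<in> C" if "(w, u) \<in> (D \<inter> Q' \<times> Q')\<^sup>*" for u
      using that
    proof (induction rule: rtrancl_induct)
      case base then show ?case using w by blast
    next
      case (step u u')
      have "(a, u') \<notin> D"
      proof
        assume au: "(a, u') \<in> D"
        have "u' \<in> B" using bip'[OF au less.prems(1)] step unfolding Q'_def by blast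
        then have "u' \<in> S" using au step sym unfolding S_def by blast
        then show False using Sc step unfolding Q'_def by blast
      qed
      then have "u' \<in> Q" using step unfolding Q'_def Q by blast
      then show ?case using \<open>u \<in> C\<close> step \<open>\<And>w w'. w \<in> C \<Longrightarrow> (w, w') \<in> D \<Longrightarrow> w' \<in> Q \<Longrightarrow> w' \<in> C\<close> by blast
    qed
    have cC': "c \<notin> C'"
    proof
      assume "c \<in> C'"
      moreover have "w \<noteq> c" using w c AB by blast
      ultimately obtain p where "(p, c) \<in> D" "p \<in> Q'" unfolding C'_def by (auto elim: rtranclE)
      then show False using sym unfolding Q'_def by blast
    qed
    then have less': "card C' < card C"
      using c sub finC by (intro psubset_card_mono) (auto simp: C'_def)
    \<comment> \<open>If no neighbour of \<open>c\<close> were attached to \<open>C'\<close>, walks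
      inside \<open>Q\<close> could not leave \<open>C'\<close>, which would then absorb all of
      \<open>C\<close>, including \<open>c\<close>.\<close>
    have "\<exists>s1 c1. s1 \<in> B \<and> (c, s1) \<in> D \<and> c1 \<in> C' \<and> (s1, c1) \<in> D"
    proof (rule ccontr)
      assume no: "\<not> ?thesis"
      have "u \<in> C'" if "(w, u) \<in> (D \<inter> Q \<times> Q)\<^sup>*" for u
        using that
      proof (induction rule: rtrancl_induct)
        case base then show ?case unfolding C'_def by blast
      next
        case (step u u')
        have u': "u' \<in> A \<union> B" using step unfolding Q by blast
        have "(c, u') \<notin> D" using no bip'[of c u'] c u' step sym by blast
        moreover have "u \<in> Q'"
        proof -
          have "w \<in> Q'" using w unfolding Q'_def by blast
          then show ?thesis using \<open>u \<in> C'\<close> unfolding C'_def by (auto elim: rtranclE)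
        qed
        ultimately have "(u, u') \<in> D \<inter> Q' \<times> Q'" using step u' unfolding Q'_def by blast
        then show ?case using \<open>u \<in> C'\<close> unfolding C'_def by (auto intro: rtrancl_into_rtrancl)
      qed
      moreover have "(w, c) \<in> (D \<inter> Q \<times> Q)\<^sup>*"
        using symQ[of v w Q] w c unfolding C by (auto intro: rtrancl_trans)
      ultimately show False using cC' by blast
    qed
    then obtain s1 c1 where "s1 \<in> B" "(c, s1) \<in> D" "c1 \<in> C'" "(s1, c1) \<in> D" by blast
    then show False using less.hyps[OF less' c(2) w(2,3) Q'_def C'_def] by blast
  next
    case False
    then have CB: "(c, w) \<in> D" if "w \<in> C" "w \<in> B" for w using that by blast
    \<comment> \<open>Neighbours of \<open>x\<close> lie in \<open>S\<close> or in \<open>C\<close>,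
      and \<open>c\<close> is adjacent to all vertices of \<open>B\<close> there; equal degrees turn
      the inclusion into equality.\<close>
    have nb: "D `` {x} \<inter> B = D `` {c} \<inter> B" if x: "x \<in> C" "x \<in> A" for x
    proof (rule card_subset_eq)
      show "finite (D `` {c} \<inter> B)" using finB by simp
      show "card (D `` {x} \<inter> B) = card (D `` {c} \<inter> B)" using degA x c by blast
      show "D `` {x} \<inter> B \<subseteq> D `` {c} \<inter> B"
      proof
        fix u assume u: "u \<in> D `` {x} \<inter> B"
        show "u \<in> D `` {c} \<inter> B"
        proof (cases "(a, u) \<in> D")
          case True
          then have "u \<in> S" using u x sym unfolding S_def by blast
          then show ?thesis using Sc u by blast
        next
          case False
          then have "u \<in> Q" using u unfolding Q by blast
          then show ?thesis using step[OF x(1)] u CB by blast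
        qed
      qed
    qed
    \<comment> \<open>The degree contradiction in \<open>B\<close>: all neighbours of
      \<open>v\<close> in \<open>A\<close> lie in \<open>C\<close>, while \<open>s0\<close> is
      adjacent to all of \<open>C \<inter> A\<close> and also to \<open>a\<close>.\<close>
    have "D `` {v} \<inter> A \<subseteq> C \<inter> A"
    proof
      fix u assume u: "u \<in> D `` {v} \<inter> A"
      then have "u \<in> Q" using AB(1) less.prems(1) col[of a u] unfolding Q by blast
      then show "u \<in> C \<inter> A" using u step[OF vC] by blast
    qed
    then have "card (D `` {v} \<inter> A) \<le> card (C \<inter> A)" using finA by (intro card_mono) auto
    also have "\<dots> < card (insert a (C \<inter> A))" using aC finA by simp
    also have "\<dots> \<le> card (D `` {s0} \<inter> A)"
    proof (rule card_mono)
      show "finite (D `` {s0} \<inter> A)" using finA by simp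
      have "(s0, x) \<in> D" if x: "x \<in> C" "x \<in> A" for x
      proof -
        have "s0 \<in> D `` {c} \<inter> B" using Sc[OF s0S] less.prems by blast
        then have "s0 \<in> D `` {x} \<inter> B" using nb[OF x] by blast
        then show ?thesis using sym by blast
      qed
      then show "insert a (C \<inter> A) \<subseteq> D `` {s0} \<inter> A" using less.prems sym by blast
    qed
    finally show False using degB[of v s0] less.prems by simp
  qed
qed

text \<open>If the neighbourhoods differ, equal degrees yield a \<open>v\<close> adjacent to
  \<open>c\<close> but not to \<open>a\<close>. Outside the neighbourhood of \<open>a\<close>, the
  component of \<open>v\<close> contains \<open>c\<close>, so the neighbour \<open>s\<close> of
  \<open>a\<close> is attached to it, which the separator argument excludes. The parameter
  \<open>k\<close> lets either colour play the role of \<open>A\<close>.\<close>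

lemma biregular_imp_same_neighbours:
  fixes A B :: "'a set"
  assumes finA: "finite A" and finB: "finite B"
    and AB: "\<And>x. x \<in> A \<Longrightarrow> col x = k" "\<And>x. x \<in> B \<Longrightarrow> col x \<noteq> k"
    and degA: "\<And>x y. x \<in> A \<Longrightarrow> y \<in> A \<Longrightarrow> card (D `` {x} \<inter> B) = card (D `` {y} \<inter> B)"
    and degB: "\<And>x y. x \<in> B \<Longrightarrow> y \<in> B \<Longrightarrow> card (D `` {x} \<inter> A) = card (D `` {y} \<inter> A)"
    and ac: "a \<in> A" "c \<in> A" and s: "s \<in> B" "(a, s) \<in> D" "(c, s) \<in> D"
  shows "D `` {a} \<inter> B = D `` {c} \<inter> B"
proof (rule ccontr)
  assume ne: "D `` {a} \<inter> B \<noteq> D `` {c} \<inter> B"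
  interpret L: long_cycle_free D "\<lambda>x. col x = k"
    by unfold_locales (use sym col no_cycle in auto)
  have "\<not> D `` {c} \<inter> B \<subseteq> D `` {a} \<inter> B"
    using card_subset_eq[of "D `` {a} \<inter> B" "D `` {c} \<inter> B"] degA[OF ac(2,1)] finB ne by auto
  then obtain v where v: "v \<in> B" "(c, v) \<in> D" "(a, v) \<notin> D" by blast
  have "c \<in> {q \<in> A \<union> B. (a, q) \<notin> D}" "v \<in> {q \<in> A \<union> B. (a, q) \<notin> D}"
    using ac v AB col[of a c] by auto
  then have "c \<in> {w. (v, w) \<in> (D \<inter> {q \<in> A \<union> B. (a, q) \<notin> D} \<times> {q \<in> A \<union> B. (a, q) \<notin> D})\<^sup>*}"
    using sym[OF v(2)] by blast
  then show False
    using L.separator_nonempty_False[OF finA finB AB degA degB ac(1) v(1,3) refl refl s(1,2)] sym[OF s(3)]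
    by blast
qed

end

section \<open>Edges between two fibers\<close>

text \<open>The eight non-edges are all the pairs of opposite position parity that are not edges of
  the cycle. Colours settle the other pairs, and vertices of equal colour are distinct because their
  listed adjacencies differ.\<close>

lemma (in long_cycle_free) no_C8:
  assumes "(v0, v1) \<in> D" "(v1, v2) \<in> D" "(v2, v3) \<in> D" "(v3, v4) \<in> D"
    "(v4, v5) \<in> D" "(v5, v6) \<in> D" "(v6, v7) \<in> D" "(v7, v0) \<in> D"
    and "(v0, v3) \<notin> D" "(v0, v5) \<notin> D" "(v1, v4) \<notin> D" "(v1, v6) \<notin> D"
    "(v2, v5) \<notin> D" "(v2, v7) \<notin> D" "(v3, v6) \<notin> D" "(v4, v7) \<notin> D"
  shows False
proof -
  define f where "f = (!) [v0, v1, v2, v3, v4, v5, v6, v7]"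
  have f: "f 0 = v0" "f 1 = v1" "f (Suc 0) = v1" "f (Suc (Suc 0)) = v2" "f 2 = v2" "f 3 = v3" "f 4 = v4" "f 5 = v5" "f 6 = v6" "f 7 = v7"
    by (simp_all add: f_def eval_nat_numeral)
  note sy = assms(1-8)[THEN sym]
  note co = assms(1-8)[THEN col]
  have dist: "v0 \<noteq> v2" "v0 \<noteq> v4" "v0 \<noteq> v6" "v2 \<noteq> v4" "v2 \<noteq> v6" "v4 \<noteq> v6"
    "v1 \<noteq> v3" "v1 \<noteq> v5" "v1 \<noteq> v7" "v3 \<noteq> v5" "v3 \<noteq> v7" "v5 \<noteq> v7"
    using assms sy by metis+
  have even: "(v0, v2) \<notin> D" "(v0, v4) \<notin> D" "(v0, v6) \<notin> D" "(v2, v4) \<notin> D" "(v2, v6) \<notin> D" "(v4, v6) \<notin> D"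
    "(v1, v3) \<notin> D" "(v1, v5) \<notin> D" "(v1, v7) \<notin> D" "(v3, v5) \<notin> D" "(v3, v7) \<notin> D" "(v5, v7) \<notin> D"
    using co col by metis+
  have less8: "j = 0 \<or> j = 1 \<or> j = 2 \<or> j = 3 \<or> j = 4 \<or> j = 5 \<or> j = 6 \<or> j = 7" if "j < 8" for j :: nat
    using that by arith
  show False
  proof (rule no_cycle_upto_symmetry[of 8 f])
    fix i j :: nat assume "i < j" "j < 8"
    then show "f i \<noteq> f j"
      using less8[of i] less8[of j] dist co by (auto simp: f)
  next
    fix i :: nat assume "Suc i < 8"
    then show "(f i, f (Suc i)) \<in> D"
      using less8[of i] assms(1-8) by (auto simp: f)
  next
    show "(f 0, f (8 - 1)) \<in> D" using sy by (simp add: f)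
  next
    fix i j :: nat assume "Suc i < j" "j < 8" "\<not> (i = 0 \<and> j = 8 - 1)"
    then show "(f i, f j) \<notin> D"
      using less8[of i] less8[of j] assms(9-) even by (auto simp: f)
  qed simp
qed

text \<open>In \<open>no_bipartite_claw\<close> only pairs of a middle vertex and a foreign leaf are
  listed: all other non-adjacent pairs of the claw have equal colours, and distinctness follows from
  the listed adjacencies.\<close>

locale rooted_graph = coherent_configuration \<Omega> S + long_cycle_free D col
  for \<Omega> :: "'a set" and S and D and col +
  fixes \<alpha> :: 'a
  assumes adjacency_union: "union_of S D"
    and root_mem: "\<alpha> \<in> \<Omega>" and root_union: "union_of S {(\<alpha>, \<alpha>)}"
    and reachable: "x \<in> \<Omega> \<Longrightarrow> (\<alpha>, x) \<in> D\<^sup>*"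
    and no_bipartite_claw:
      "\<lbrakk>(c, m1) \<in> D; (c, m2) \<in> D; (c, m3) \<in> D; (m1, l1) \<in> D; (m2, l2) \<in> D; (m3, l3) \<in> D;
        (m1, l2) \<notin> D; (m1, l3) \<notin> D; (m2, l1) \<notin> D; (m2, l3) \<notin> D; (m3, l1) \<notin> D; (m3, l2) \<notin> D\<rbrakk> \<Longrightarrow> False"
begin

section \<open>Fibers and distance from the root\<close>

lemma adjacent_mem: "(x, y) \<in> D \<Longrightarrow> x \<in> \<Omega>" "(x, y) \<in> D \<Longrightarrow> y \<in> \<Omega>"
  using adjacency_union unfolding union_of_iff by blast+

lemma fib_mem_points: "y \<in> fib x \<Longrightarrow> y \<in> \<Omega>"
  using fib_subset by blast

lemma neighbour_transfer:
  assumes "(x, w) \<in> D" "y \<in> fib x"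
  obtains w' where "w' \<in> fib w" "(y, w') \<in> D"
proof -
  have m: "x \<in> \<Omega>" "w \<in> \<Omega>" "y \<in> \<Omega>" using adjacent_mem assms(1) fib_mem_points[OF assms(2)] by auto
  have "rel x x = rel y y" using assms(2) by (simp add: fib_def)
  then obtain w' where w': "w' \<in> \<Omega>" "rel x w = rel y w'"
    by (rule triangle[OF _ m(1) m(1) m(3) m(3) m(2)])
  have "(y, w') \<in> D" by (rule union_of_imp[OF adjacency_union w'(2) m(1,2,3) w'(1) assms(1)])
  moreover have "rel w w = rel w' w'" by (rule rel_target[OF w'(2) m(1,2,3) w'(1)])
  then have "w' \<in> fib w" using w'(1) by (simp add: fib_def)
  ultimately show thesis using that by blast
qed

lemma fib_root: "y \<in> fib \<alpha> \<Longrightarrow> y = \<alpha>"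
  using union_of_imp[OF root_union, of \<alpha> \<alpha> y y] root_mem by (auto simp: fib_def)

text \<open>A walk is transferred backwards from its end, edge by edge; it ends at \<alpha> again
  because \<alpha> is alone in its fiber.\<close>

lemma relpow_fib: "(\<alpha>, x) \<in> D ^^ n \<Longrightarrow> y \<in> fib x \<Longrightarrow> (\<alpha>, y) \<in> D ^^ n"
proof (induction n arbitrary: x y)
  case 0
  then show ?case using fib_root[of y] by auto
next
  case (Suc n)
  obtain w where w: "(\<alpha>, w) \<in> D ^^ n" "(w, x) \<in> D" using Suc.prems(1) by auto
  obtain w' where "w' \<in> fib w" "(y, w') \<in> D" by (rule neighbour_transfer[OF sym[OF w(2)] Suc.prems(2)])
  then show ?case using Suc.IH[OF w(1)] sym by auto
qed

definition level :: "'a \<Rightarrow> nat" where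
  "level x = (LEAST n. (\<alpha>, x) \<in> D ^^ n)"

lemma relpow_level: "x \<in> \<Omega> \<Longrightarrow> (\<alpha>, x) \<in> D ^^ level x"
  unfolding level_def using reachable rtrancl_power by (metis (mono_tags, lifting) LeastI_ex)

lemma level_le: "(\<alpha>, x) \<in> D ^^ n \<Longrightarrow> level x \<le> n"
  unfolding level_def by (rule Least_le)

lemma level_fib: "x \<in> \<Omega> \<Longrightarrow> y \<in> fib x \<Longrightarrow> level y = level x"
  using level_le relpow_fib relpow_level fib_sym fib_mem_points by (meson le_antisym)

lemma level_eq_0: "x \<in> \<Omega> \<Longrightarrow> level x = 0 \<Longrightarrow> x = \<alpha>"
  using relpow_level[of x] by simp

lemma level_adjacent_le: "(x, y) \<in> D \<Longrightarrow> level y \<le> Suc (level x)"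
  using relpow_level[of x] adjacent_mem by (intro level_le) auto

lemma col_relpow: "(\<alpha>, x) \<in> D ^^ n \<Longrightarrow> col x = (col \<alpha> = even n)"
proof (induction n arbitrary: x)
  case (Suc n)
  then obtain w where "(\<alpha>, w) \<in> D ^^ n" "(w, x) \<in> D" by auto
  then show ?case using Suc.IH[of w] col[of w x] by auto
qed simp

lemma col_level: "x \<in> \<Omega> \<Longrightarrow> col x = (col \<alpha> = even (level x))"
  by (rule col_relpow[OF relpow_level])

lemma level_adjacent: "(x, y) \<in> D \<Longrightarrow> level y = Suc (level x) \<or> level x = Suc (level y)"
proof -
  assume xy: "(x, y) \<in> D"
  have "level x \<noteq> level y"
    using col[OF xy] col_level adjacent_mem[OF xy] by auto
  then show ?thesis
    using level_adjacent_le[OF xy] level_adjacent_le[OF sym[OF xy]] by linarith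
qed

lemma parent:
  assumes "x \<in> \<Omega>" "level x = Suc n"
  obtains y where "(x, y) \<in> D" "level y = n"
proof -
  obtain y where y: "(\<alpha>, y) \<in> D ^^ n" "(y, x) \<in> D" using relpow_level[OF assms(1)] assms(2) by auto
  have "level y \<le> n" by (rule level_le[OF y(1)])
  then show thesis using that level_adjacent_le[OF y(2)] assms(2) sym[OF y(2)] by simp
qed

text \<open>Degrees between two fibers are constant, so the biregular result applies: each component
  between two fibers is complete bipartite.\<close>

lemma same_neighbours_fib:
  assumes c: "c \<in> fib a" and s: "(a, s) \<in> D" "(c, s) \<in> D" and t: "t \<in> fib s" "(a, t) \<in> D"
  shows "(c, t) \<in> D"
proof -
  have m: "a \<in> \<Omega>" "s \<in> \<Omega>" using s adjacent_mem by auto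
  have colf: "col y = col x" if "x \<in> \<Omega>" "y \<in> fib x" for x y
    using col_level[of x] col_level[of y] level_fib[OF that] fib_mem_points[OF that(2)] that(1) by simp
  have deg: "card (D `` {y} \<inter> fib z) = card (D `` {w} \<inter> fib z)" if "y \<in> fib x" "w \<in> fib x" for x y z w
    by (rule card_neighbours_fib[OF adjacency_union]) (use that in \<open>auto simp: fib_def\<close>)
  have "D `` {a} \<inter> fib s = D `` {c} \<inter> fib s"
  proof (rule biregular_imp_same_neighbours[of "fib a" "fib s" "col a"])
    show "finite (fib a)" "finite (fib s)" using fib_subset finite_points finite_subset by blast+
    show "col x = col a" if "x \<in> fib a" for x by (rule colf[OF m(1) that])
    show "col x \<noteq> col a" if "x \<in> fib s" for x using colf[OF m(2) that] col[OF s(1)] by simp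
    show "card (D `` {x} \<inter> fib s) = card (D `` {y} \<inter> fib s)" if "x \<in> fib a" "y \<in> fib a" for x y
      by (rule deg[OF that])
    show "card (D `` {x} \<inter> fib a) = card (D `` {y} \<inter> fib a)" if "x \<in> fib s" "y \<in> fib s" for x y
      by (rule deg[OF that])
    show "a \<in> fib a" "s \<in> fib s" using m by simp_all
  qed (rule c s)+
  then show ?thesis using t by blast
qed

text \<open>The fiber of a parent of \<open>a1\<close> satisfies the claim by induction, so one of its vertices \<open>c\<close> is
  adjacent to two of the \<open>a\<close>'s; it is the center of a bipartite claw whose third leg goes up
  towards the root, or turns at the root to a vertex of level 1.\<close>

lemma no_three_separated_edges_up:
  assumes "level b1 = Suc (level a1)"
    and "a2 \<in> fib a1" "a3 \<in> fib a1" "b2 \<in> fib b1" "b3 \<in> fib b1"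
    and "(a1, b1) \<in> D" "(a2, b2) \<in> D" "(a3, b3) \<in> D"
    and "(a1, b2) \<notin> D" "(a1, b3) \<notin> D" "(a2, b1) \<notin> D" "(a2, b3) \<notin> D" "(a3, b1) \<notin> D" "(a3, b2) \<notin> D"
  shows False
  using assms
proof (induction "level a1" arbitrary: a1 a2 a3 b1 b2 b3 rule: less_induct)
  case less
  note up = less.prems(1) and fibs = less.prems(2-5) and edges = less.prems(6-8)
  have m: "a1 \<in> \<Omega>" "b1 \<in> \<Omega>" using adjacent_mem edges by auto
  have "a1 \<noteq> \<alpha>" using fib_root[of a2] fibs edges less.prems(11) by auto
  then obtain n where n: "level a1 = Suc n" using level_eq_0[OF m(1)] by (cases "level a1") auto
  obtain c1 where c1: "(a1, c1) \<in> D" "level c1 = n" by (rule parent[OF m(1) n])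
  obtain c2 where c2: "c2 \<in> fib c1" "(a2, c2) \<in> D" by (rule neighbour_transfer[OF c1(1) fibs(1)])
  obtain c3 where c3: "c3 \<in> fib c1" "(a3, c3) \<in> D" by (rule neighbour_transfer[OF c1(1) fibs(2)])
  have c1m: "c1 \<in> \<Omega>" using c1 adjacent_mem by blast
  \<comment> \<open>Here \<open>c\<close> is a common parent of \<open>p\<close> and
    \<open>q\<close>. If \<open>r\<close> is adjacent to \<open>c\<close> as well, the three given
    edges are the ends of the legs; otherwise \<open>p\<close> and \<open>q\<close> give two legs
    and the third starts at a parent \<open>e\<close> of \<open>c\<close>.\<close>
  have key: False
    if c: "c \<in> fib c1" and pqr: "p \<in> fib a1" "q \<in> fib a1" "r \<in> fib a1"
      and pqr': "p' \<in> fib b1" "q' \<in> fib b1" "r' \<in> fib b1"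
      and adj: "(p, p') \<in> D" "(q, q') \<in> D" "(r, r') \<in> D" "(p, c) \<in> D" "(q, c) \<in> D"
      and nadj: "(p, q') \<notin> D" "(p, r') \<notin> D" "(q, p') \<notin> D" "(q, r') \<notin> D" "(r, p') \<notin> D" "(r, q') \<notin> D"
    for c p q r p' q' r'
  proof (cases "(r, c) \<in> D")
    case True
    then show False using no_bipartite_claw[of c p q r p' q' r'] adj nadj sym by blast
  next
    case False
    have lev: "level c = n" "level p = Suc n" "level q = Suc n" "level p' = Suc (Suc n)" "level q' = Suc (Suc n)"
      using level_fib[OF c1m c] c1 level_fib[OF m(1)] level_fib[OF m(2)] pqr pqr' n up by auto
    have cm: "c \<in> \<Omega>" using adjacent_mem adj by blast
    have rp: "r \<in> fib p" and qp: "q \<in> fib p" and pq: "p \<in> fib q" and rq: "r \<in> fib q"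
      using pqr by (auto simp: fib_def)
    obtain d where d: "d \<in> fib c" "(r, d) \<in> D" by (rule neighbour_transfer[OF adj(4) rp])
    have pd: "(p, d) \<notin> D" using same_neighbours_fib[of c d p r] d False adj sym rp fib_sym[OF d(1) cm] by blast
    have qd: "(q, d) \<notin> D" using same_neighbours_fib[of c d q r] d False adj sym rq fib_sym[OF d(1) cm] by blast
    \<comment> \<open>The fiber of \<open>c\<close> contains the further point \<open>d\<close>,
      which \<open>p\<close> distinguishes from \<open>c\<close>.\<close>
    have "c \<noteq> \<alpha>" using d fib_root[of d] adj pd by auto
    then obtain k where k: "n = Suc k" using level_eq_0[OF cm] lev(1) by (cases n) auto
    obtain e where e: "(c, e) \<in> D" "level e = k" by (rule parent[OF cm]) (use lev k in simp)
    have em: "e \<in> \<Omega>" using e adjacent_mem by blast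
    have ep: "(e, p') \<notin> D" "(e, q') \<notin> D"
      using level_adjacent[of e p'] level_adjacent[of e q'] lev k e by auto
    show False
    proof (cases k)
      case 0
      \<comment> \<open>The leg cannot go above the root. It turns down to \<open>d\<close>, which
        has level 1 like \<open>c\<close> and is adjacent to neither \<open>p\<close> nor
        \<open>q\<close>.\<close>
      then have "e = \<alpha>" using level_eq_0[OF em] e by simp
      have "level d = Suc 0" using level_fib[OF cm d(1)] lev k 0 by simp
      then obtain u where u: "(d, u) \<in> D" "level u = 0" using parent[of d 0] fib_mem_points[OF d(1)] by blast
      then have "u = \<alpha>" using level_eq_0 adjacent_mem by blast
      then have "(e, d) \<in> D" using u sym \<open>e = \<alpha>\<close> by blast
      then show False
        using no_bipartite_claw[of c p q e p' q' d] adj nadj pd qd ep e sym by blast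
    next
      case (Suc j)
      obtain g where g: "(e, g) \<in> D" "level g = j" by (rule parent[OF em]) (use e Suc in simp)
      have "(p, g) \<notin> D" "(q, g) \<notin> D"
        using level_adjacent[of p g] level_adjacent[of q g] lev k g Suc by auto
      then show False
        using no_bipartite_claw[of c p q e p' q' g] adj nadj ep e g sym by blast
    qed
  qed
  have a1f: "a1 \<in> fib a1" and b1f: "b1 \<in> fib b1" and c1f: "c1 \<in> fib c1" using m c1m by auto
  \<comment> \<open>The induction hypothesis one level up forbids that the three edges between
    parents and \<open>a\<close>'s are separated, so some parent is shared by two of the
    \<open>a\<close>'s; each of the six ways is an instance of \<open>key\<close>.\<close>
  have "level c1 < level a1" "level a1 = Suc (level c1)" using n c1 by auto
  then have "\<not> ((c1, a2) \<notin> D \<and> (c1, a3) \<notin> D \<and> (c2, a1) \<notin> D \<and> (c2, a3) \<notin> D \<and> (c3, a1) \<notin> D \<and> (c3, a2) \<notin> D)"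
    using less.hyps[of c1 a1 c2 c3 a2 a3] c1 c2 c3 fibs sym by blast
  then consider "(a2, c1) \<in> D" | "(a3, c1) \<in> D" | "(a1, c2) \<in> D" | "(a3, c2) \<in> D" | "(a1, c3) \<in> D" | "(a2, c3) \<in> D"
    using sym by blast
  then show False
  proof cases
    case 1 show False by (rule key[OF c1f a1f fibs(1,2) b1f fibs(3,4) edges c1(1) 1 less.prems(9-14)])
  next
    case 2 show False
      by (rule key[OF c1f a1f fibs(2,1) b1f fibs(4,3) edges(1,3,2) c1(1) 2 less.prems(10,9,13,14,11,12)])
  next
    case 3 show False by (rule key[OF c2(1) a1f fibs(1,2) b1f fibs(3,4) edges 3 c2(2) less.prems(9-14)])
  next
    case 4 show False
      by (rule key[OF c2(1) fibs(1,2) a1f fibs(3,4) b1f edges(2,3,1) c2(2) 4 less.prems(12,11,14,13,9,10)])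
  next
    case 5 show False
      by (rule key[OF c3(1) a1f fibs(2,1) b1f fibs(4,3) edges(1,3,2) 5 c3(2) less.prems(10,9,13,14,11,12)])
  next
    case 6 show False
      by (rule key[OF c3(1) fibs(1,2) a1f fibs(3,4) b1f edges(2,3,1) 6 c3(2) less.prems(12,11,14,13,9,10)])
  qed
qed

section \<open>Components between two fibers, and twin classes\<close>

lemma no_three_separated_edges:
  assumes "a2 \<in> fib a1" "a3 \<in> fib a1" "b2 \<in> fib b1" "b3 \<in> fib b1"
    and "(a1, b1) \<in> D" "(a2, b2) \<in> D" "(a3, b3) \<in> D"
    and "(a1, b2) \<notin> D" "(a1, b3) \<notin> D" "(a2, b1) \<notin> D" "(a2, b3) \<notin> D" "(a3, b1) \<notin> D" "(a3, b2) \<notin> D"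
  shows False
proof -
  have symn: "(y, x) \<notin> D" if "(x, y) \<notin> D" for x y using that sym by blast
  from level_adjacent[OF assms(5)] show False
  proof
    assume "level b1 = Suc (level a1)"
    then show False by (rule no_three_separated_edges_up[OF _ assms])
  next
    assume "level a1 = Suc (level b1)"
    then show False
      by (rule no_three_separated_edges_up[OF _ assms(3,4,1,2) assms(5-7)[THEN sym]
            assms(10,12,8,13,9,11)[THEN symn]])
  qed
qed

text \<open>\<open>z\<close> and \<open>z'\<close> represent different components. A
  \<open>w\<close> adjacent to neither would, with a neighbour of its own in the fiber of
  \<open>z\<close>, give a third separated edge.\<close>

lemma two_classes:
  assumes v: "v \<in> fib u" and z: "z' \<in> fib z" "(u, z) \<in> D" "(v, z') \<in> D" "(v, z) \<notin> D" and w: "w \<in> fib u"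
  shows "(w, z') \<in> D \<longleftrightarrow> (w, z) \<notin> D"
proof
  have m: "u \<in> \<Omega>" "z \<in> \<Omega>" using z adjacent_mem by auto
  have same: "(y, z1) \<in> D"
    if "x \<in> fib u" "y \<in> fib u" "z1 \<in> fib z" "z2 \<in> fib z" "(x, z2) \<in> D" "(y, z2) \<in> D" "(x, z1) \<in> D" for x y z1 z2
    using same_neighbours_fib[OF _ that(5,6) _ that(7)] that(1-4) by (simp add: fib_def)
  have uf: "u \<in> fib u" and zf: "z \<in> fib z" using m by auto
  show "(w, z) \<notin> D" if "(w, z') \<in> D" using same[OF w v zf z(1) that z(3)] z(4) by blast
  show "(w, z') \<in> D" if wz: "(w, z) \<notin> D"
  proof (rule ccontr)
    assume wz': "(w, z') \<notin> D"
    obtain x where x: "x \<in> fib z" "(w, x) \<in> D" by (rule neighbour_transfer[OF z(2) w])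
    have "(u, z') \<notin> D" using same[OF uf v zf z(1) _ z(3,2)] z(4) by blast
    moreover have "(u, x) \<notin> D" using same[OF uf w zf x(1) _ x(2) z(2)] wz by blast
    moreover have "(v, x) \<notin> D" using same[OF v w z(1) x(1) _ x(2) z(3)] wz' by blast
    ultimately show False
      using no_three_separated_edges[OF v w z(1) x(1) z(2,3) x(2)] z(4) wz wz' by blast
  qed
qed

text \<open>\<open>z\<close> and \<open>z'\<close> have equal degrees into the fiber of
  \<open>u\<close>, so the two components cut it into halves.\<close>

lemma card_two_classes:
  assumes v: "v \<in> fib u" and z: "z' \<in> fib z" "(u, z) \<in> D" "(v, z') \<in> D" "(v, z) \<notin> D"
  shows "2 * card (D `` {z} \<inter> fib u) = card (fib u)"
proof -
  have fin: "finite (fib u)" using fib_subset finite_points finite_subset by blast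
  have zm: "z \<in> \<Omega>" using z adjacent_mem by blast
  have "fib u = (D `` {z} \<inter> fib u) \<union> (D `` {z'} \<inter> fib u)" "(D `` {z} \<inter> fib u) \<inter> (D `` {z'} \<inter> fib u) = {}"
    using two_classes[OF assms] sym by blast+
  then have "card (fib u) = card (D `` {z} \<inter> fib u) + card (D `` {z'} \<inter> fib u)"
    using fin by (metis card_Un_disjoint finite_Int)
  then show ?thesis using card_neighbours_fib[OF adjacency_union zm z(1), of u] by simp
qed

text \<open>If some \<open>n\<close> separated \<open>y\<close> from \<open>y'\<close>, the fiber
  would be halved in two different ways, by \<open>z\<close> and by \<open>n\<close>, and the four
  resulting parts would carry an induced 8-cycle.\<close>

lemma twins_aux:
  assumes y': "y' \<in> fib y" and z: "(y, z) \<in> D" "(y', z) \<in> D"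
    and pq: "p \<in> fib y" "q \<in> fib z" "(p, q) \<notin> D" and n: "(y, n) \<in> D"
  shows "(y', n) \<in> D"
proof (rule ccontr)
  assume y'n: "(y', n) \<notin> D"
  have m: "y \<in> \<Omega>" "z \<in> \<Omega>" "q \<in> \<Omega>" using z adjacent_mem pq fib_mem_points by auto
  have fin: "finite (fib y)" using fib_subset finite_points finite_subset by blast
  have "p \<notin> D `` {q} \<inter> fib y" using pq sym by blast
  then have "D `` {q} \<inter> fib y \<subset> fib y" using pq(1) by blast
  then have "card (D `` {q} \<inter> fib y) < card (fib y)" by (rule psubset_card_mono[OF fin])
  then have "card (D `` {z} \<inter> fib y) < card (fib y)"
    using card_neighbours_fib[OF adjacency_union m(2) pq(2), of y] by simp
  then have "\<not> fib y \<subseteq> D `` {z}" by (metis inf.absorb2 less_irrefl)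
  then obtain x where x: "x \<in> fib y" "(x, z) \<notin> D" using sym by blast
  obtain z' where z': "z' \<in> fib z" "(x, z') \<in> D" by (rule neighbour_transfer[OF z(1) x(1)])
  obtain n' where n': "n' \<in> fib n" "(y', n') \<in> D" by (rule neighbour_transfer[OF n y'])
  note Z = two_classes[OF x(1) z'(1) z(1) z'(2) x(2)]
  note N = two_classes[OF y' n'(1) n n'(2) y'n]
  \<comment> \<open>All four parts generated by these halves are nonempty: \<open>y\<close> lies in
    both, \<open>y'\<close> only in \<open>?Z\<close>, and since the halves have equal size there
    are also a \<open>w\<close> only in \<open>?N\<close> and a \<open>w'\<close> in
    neither.\<close>
  let ?Z = "D `` {z} \<inter> fib y" and ?N = "D `` {n} \<inter> fib y"
  have cards: "2 * card ?Z = card (fib y)" "2 * card ?N = card (fib y)"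
    using card_two_classes[OF x(1) z'(1) z(1) z'(2) x(2)] card_two_classes[OF y' n'(1) n n'(2) y'n] by auto
  have "\<not> ?N \<subseteq> ?Z"
  proof
    assume "?N \<subseteq> ?Z"
    moreover have "y' \<in> ?Z" "y' \<notin> ?N" using y' z y'n sym by blast+
    ultimately have "?N \<subset> ?Z" by blast
    then have "card ?N < card ?Z" using fin by (intro psubset_card_mono) auto
    then show False using cards by simp
  qed
  then obtain w where w: "w \<in> fib y" "(w, n) \<in> D" "(w, z) \<notin> D" using sym by blast
  have "\<exists>w' \<in> fib y. (w', n) \<notin> D \<and> (w', z) \<notin> D"
  proof (rule ccontr)
    assume "\<not> ?thesis"
    then have "fib y = ?N \<union> ?Z" using sym by blast
    then have "card (fib y) + card (?N \<inter> ?Z) = card ?N + card ?Z"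
      using card_Un_Int[of ?N ?Z] fin by simp
    then have "card (?N \<inter> ?Z) = 0" using cards by simp
    moreover have "y \<in> ?N \<inter> ?Z" using m n z sym by auto
    ultimately show False using fin by (metis card_eq_0_iff empty_iff finite_Int)
  qed
  then obtain w' where w': "w' \<in> fib y" "(w', n) \<notin> D" "(w', z) \<notin> D" by blast
  have yf: "y \<in> fib y" using m by simp
  have symn: "(b, a) \<notin> D" if "(a, b) \<notin> D" for a b using that sym by blast
  \<comment> \<open>Within the fiber of \<open>y\<close>, the vertices \<open>z'\<close> and
    \<open>n'\<close> see exactly the complements of \<open>?Z\<close> and \<open>?N\<close>, so the
    four representatives alternate with \<open>z\<close>, \<open>n\<close>, \<open>z'\<close>,
    \<open>n'\<close> around the cycle.\<close>
  show False
  proof (rule no_C8[of z y n w z' w' n' y'])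
    show "(z, y) \<in> D" "(y, n) \<in> D" "(n, w) \<in> D" "(n', y') \<in> D" "(y', z) \<in> D"
      using z n w n' sym by blast+
    show "(w, z') \<in> D" "(z', w') \<in> D" "(w', n') \<in> D" using Z[OF w(1)] Z[OF w'(1)] N[OF w'(1)] w w' sym by blast+
    show "(z, w) \<notin> D" "(z, w') \<notin> D" "(n, w') \<notin> D" "(n, y') \<notin> D" using w w' y'n symn by blast+
    show "(y, z') \<notin> D" "(y, n') \<notin> D" "(w, n') \<notin> D" "(z', y') \<notin> D"
      using Z[OF yf] N[OF yf] N[OF w(1)] Z[OF y'] z n w symn by blast+
  qed
qed

text \<open>One common neighbour in a fiber not completely joined to that of \<open>y\<close>
  already decides adjacency to the whole graph.\<close>

lemma twins:
  assumes y': "y' \<in> fib y" and z: "(y, z) \<in> D" "(y', z) \<in> D"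
    and pq: "p \<in> fib y" "q \<in> fib z" "(p, q) \<notin> D"
  shows "D `` {y} = D `` {y'}"
proof -
  have "y \<in> fib y'" "p \<in> fib y'" using y' pq adjacent_mem[OF z(1)] by (auto simp: fib_def)
  then show ?thesis using twins_aux[OF assms] twins_aux[OF _ z(2,1) _ pq(2,3)] by blast
qed

lemma twins_of_three_aux:
  assumes "y \<in> fib x" "w \<in> fib x" "(x, n) \<in> D" "(y, n) \<notin> D"
  shows "D `` {x} = D `` {w} \<or> D `` {y} = D `` {w}"
proof -
  have m: "x \<in> \<Omega>" "y \<in> \<Omega>" "w \<in> \<Omega>" "n \<in> \<Omega>" using assms adjacent_mem fib_mem_points by auto
  obtain n' where n': "n' \<in> fib n" "(y, n') \<in> D" by (rule neighbour_transfer[OF assms(3,1)])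
  show ?thesis
  proof (cases "(w, n) \<in> D")
    case True
    have "D `` {x} = D `` {w}" by (rule twins[OF assms(2,3) True assms(1) _ assms(4)]) (use m in simp)
    then show ?thesis ..
  next
    case False
    then have "(w, n') \<in> D" using two_classes[OF assms(1) n'(1) assms(3) n'(2) assms(4,2)] by simp
    moreover have "w \<in> fib y" "y \<in> fib y" "n \<in> fib n'" using assms(1,2) n'(1) m by (auto simp: fib_def)
    ultimately have "D `` {y} = D `` {w}" using n'(2) assms(4) by (intro twins[of w y n' y n])
    then show ?thesis ..
  qed
qed

text \<open>The way in which "at most two twin classes per fiber" is used. A vertex separating
  \<open>x\<close> from \<open>y\<close> splits the fiber in two, and \<open>w\<close> shares a
  component, hence its neighbours, with one of them.\<close>

lemma twins_of_three:
  assumes "x \<in> \<Omega>" "y \<in> fib x" "w \<in> fib x"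
  shows "D `` {x} = D `` {y} \<or> D `` {x} = D `` {w} \<or> D `` {y} = D `` {w}"
proof (cases "D `` {x} = D `` {y}")
  case False
  then consider n where "(x, n) \<in> D" "(y, n) \<notin> D" | n where "(y, n) \<in> D" "(x, n) \<notin> D" by blast
  then show ?thesis
  proof cases
    case 1 then show ?thesis using twins_of_three_aux[OF assms(2,3)] by blast
  next
    case 2
    have "x \<in> fib y" "w \<in> fib y" using assms by (auto simp: fib_def)
    then show ?thesis using twins_of_three_aux[of x y w n] 2 by blast
  qed
qed simp

end

section \<open>Separability\<close>

lemma bij_betw_fibrewise:
  assumes "finite A" "finite B" and card: "\<And>c. card {x \<in> A. k x = c} = card {y \<in> B. l y = c}"
  obtains f where "bij_betw f A B" "\<forall>x\<in>A. l (f x) = k x"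
proof -
  have "\<exists>g. bij_betw g {x \<in> A. k x = c} {y \<in> B. l y = c}" for c
    by (rule finite_same_card_bij) (use assms in auto)
  then obtain g where g: "\<And>c. bij_betw (g c) {x \<in> A. k x = c} {y \<in> B. l y = c}" by metis
  define f where "f x = g (k x) x" for x
  have f: "f x \<in> B \<and> l (f x) = k x" if "x \<in> A" for x
    using bij_betwE[OF g[of "k x"]] that by (auto simp: f_def)
  have "bij_betw f A B"
  proof (rule bij_betw_imageI)
    show "inj_on f A"
    proof (rule inj_onI)
      fix x y assume xy: "x \<in> A" "y \<in> A" "f x = f y"
      then have "k x = k y" using f by metis
      then show "x = y"
        using xy bij_betw_imp_inj_on[OF g[of "k y"]] by (simp add: f_def inj_on_def)
    qed
    have "y \<in> f ` A" if "y \<in> B" for y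
    proof -
      have "y \<in> g (l y) ` {x \<in> A. k x = l y}"
        using bij_betw_imp_surj_on[OF g[of "l y"]] that by blast
      then obtain x where x: "x \<in> A" "k x = l y" "y = g (l y) x" by blast
      have "y = f x" unfolding f_def x(2) by (rule x(3))
      then show ?thesis using x(1) by (rule image_eqI)
    qed
    then show "f ` A = B" using f by blast
  qed
  then show thesis using that f by blast
qed

section \<open>Linkage classes, base points and the bijection\<close>

context rooted_graph
begin

text \<open>The disjunct \<open>z \<in> fib y\<close> places each whole fiber in one linkage
  class.\<close>

definition linked :: "'a rel" where
  "linked = {(y, z). y \<in> \<Omega> \<and> z \<in> \<Omega> \<and>
    (z \<in> fib y \<or> ((fib y \<times> fib z) \<inter> D \<noteq> {} \<and> \<not> fib y \<times> fib z \<subseteq> D))}"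

text \<open>Points of one linkage class choose from the same set and hence obtain the same base
  point.\<close>

definition base :: "'a \<Rightarrow> 'a" where
  "base y = (SOME x. (y, x) \<in> linked\<^sup>*)"

lemma sym_linked: "sym (linked\<^sup>*)"
proof (rule sym_rtrancl, rule symI)
  fix y z assume yz: "(y, z) \<in> linked"
  then have m: "y \<in> \<Omega>" "z \<in> \<Omega>" unfolding linked_def by auto
  show "(z, y) \<in> linked"
  proof (cases "z \<in> fib y")
    case True
    then show ?thesis using m fib_sym unfolding linked_def by blast
  next
    case False
    then have "(fib y \<times> fib z) \<inter> D \<noteq> {}" "\<not> fib y \<times> fib z \<subseteq> D" using yz unfolding linked_def by auto
    then have "(fib z \<times> fib y) \<inter> D \<noteq> {}" "\<not> fib z \<times> fib y \<subseteq> D" using sym by blast+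
    then show ?thesis using m unfolding linked_def by blast
  qed
qed

lemma base_eq: "(y, z) \<in> linked\<^sup>* \<Longrightarrow> base y = base z"
proof -
  assume yz: "(y, z) \<in> linked\<^sup>*"
  then have "(y, x) \<in> linked\<^sup>* \<longleftrightarrow> (z, x) \<in> linked\<^sup>*" for x
    using symD[OF sym_linked] by (meson rtrancl_trans)
  then show ?thesis unfolding base_def by simp
qed

lemma base_fib: "y \<in> \<Omega> \<Longrightarrow> z \<in> fib y \<Longrightarrow> base z = base y"
proof -
  assume "y \<in> \<Omega>" "z \<in> fib y"
  then have "(y, z) \<in> linked" using fib_mem_points unfolding linked_def by blast
  then have "(y, z) \<in> linked\<^sup>*" by (rule r_into_rtrancl)
  then show "base z = base y" by (rule base_eq[symmetric])
qed

lemma linked_base: "(base y, y) \<in> linked\<^sup>*"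
proof -
  have "(y, base y) \<in> linked\<^sup>*" unfolding base_def by (rule someI[of _ y]) simp
  then show ?thesis by (rule symD[OF sym_linked])
qed

lemma base_mem: "y \<in> \<Omega> \<Longrightarrow> base y \<in> \<Omega>"
  using linked_base[of y] by (cases rule: converse_rtranclE) (auto simp: linked_def)

text \<open>Being a twin of \<open>x\<close> is visible in the basis relation from \<open>x\<close>:
  a neighbour \<open>n\<close> of \<open>x\<close> and \<open>w\<close> has a copy \<open>n'\<close>
  in its fiber adjacent to \<open>x\<close> and \<open>w'\<close>, and completeness of the
  components makes \<open>n\<close> adjacent to \<open>w'\<close> too.\<close>

lemma twin_rel:
  assumes "x \<in> \<Omega>" "w \<in> fib x" "w' \<in> fib x" "D `` {x} = D `` {w}" "rel x w = rel x w'"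
  shows "D `` {x} = D `` {w'}"
proof -
  have m: "w \<in> \<Omega>" "w' \<in> \<Omega>" using assms fib_mem_points by auto
  have forward: "(w', n) \<in> D" if n: "(x, n) \<in> D" for n
  proof -
    have nm: "n \<in> \<Omega>" using n adjacent_mem by blast
    obtain n' where n': "n' \<in> \<Omega>" "rel x n = rel x n'" "rel n w = rel n' w'"
      by (rule triangle[OF assms(5,1) m(1) assms(1) m(2) nm])
    have "(n, w) \<in> D" using n assms(4) sym by blast
    then have "(n', w') \<in> D" by (rule union_of_imp[OF adjacency_union n'(3) nm m(1) n'(1) m(2)])
    moreover have "(x, n') \<in> D" by (rule union_of_imp[OF adjacency_union n'(2) assms(1) nm assms(1) n'(1) n])
    moreover have "rel n n = rel n' n'" by (rule rel_target[OF n'(2) assms(1) nm assms(1) n'(1)])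
    then have "n \<in> fib n'" using nm by (simp add: fib_def)
    ultimately show ?thesis using same_neighbours_fib[OF assms(3)] n sym by blast
  qed
  moreover have "(x, n) \<in> D" if n: "(w', n) \<in> D" for n
  proof -
    have xw': "x \<in> fib w'" by (rule fib_sym[OF assms(3,1)])
    obtain n' where n': "n' \<in> fib n" "(x, n') \<in> D" by (rule neighbour_transfer[OF n xw'])
    have "n \<in> fib n'" using fib_sym[OF n'(1)] adjacent_mem n by blast
    then show ?thesis using same_neighbours_fib[OF xw' forward[OF n'(2)] n'(2)] n by blast
  qed
  ultimately show ?thesis by blast
qed

text \<open>Inside the fiber of \<open>x\<close> there are at most two twin classes, and that of
  \<open>x\<close> is recognised by \<open>twin_rel\<close>. Along a link, a neighbour
  \<open>u\<close> of \<open>w\<close> is copied to a neighbour \<open>u'\<close> of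
  \<open>w'\<close>; by induction these are twins, so \<open>w\<close> and \<open>w'\<close> share
  the neighbour \<open>u\<close> and are twins themselves.\<close>

lemma linked_determines_twins:
  assumes x: "x \<in> \<Omega>" and xy: "(x, y) \<in> linked\<^sup>*" and w: "w \<in> fib y" "w' \<in> fib y" "rel x w = rel x w'"
  shows "D `` {w} = D `` {w'}"
  using xy w
proof (induction arbitrary: w w' rule: rtrancl_induct)
  case base
  note b = base
  from twins_of_three[OF x b(1,2)] show ?case
    using twin_rel[OF x b(1,2) _ b(3)] twin_rel[OF x b(2,1) _ b(3)[symmetric]] by metis
next
  case (step y z)
  have m: "y \<in> \<Omega>" "z \<in> \<Omega>" using step.hyps(2) unfolding linked_def by auto
  have wm: "w \<in> \<Omega>" "w' \<in> \<Omega>" using step.prems fib_mem_points by auto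
  show ?case
  proof (cases "z \<in> fib y")
    case True
    then have "fib z = fib y" by (rule fib_eq)
    then show ?thesis using step.IH step.prems by blast
  next
    case False
    then have link: "(fib y \<times> fib z) \<inter> D \<noteq> {}" "\<not> fib y \<times> fib z \<subseteq> D"
      using step.hyps(2) unfolding linked_def by auto
    then obtain p q where pq: "p \<in> fib y" "q \<in> fib z" "(p, q) \<in> D" by blast
    have "w \<in> fib q" using step.prems(1) pq(2) by (simp add: fib_def)
    then obtain u where u: "u \<in> fib p" "(w, u) \<in> D" by (rule neighbour_transfer[OF sym[OF pq(3)]])
    have um: "u \<in> \<Omega>" using u adjacent_mem by blast
    have uy: "u \<in> fib y" using u(1) pq(1) by (simp add: fib_def)
    obtain u' where u': "u' \<in> \<Omega>" "rel x u = rel x u'" "rel u w = rel u' w'"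
      by (rule triangle[OF step.prems(3) x wm(1) x wm(2) um])
    have "rel u u = rel u' u'" by (rule rel_target[OF u'(2) x um x u'(1)])
    then have "u' \<in> fib y" using uy u'(1) by (simp add: fib_def)
    then have "D `` {u} = D `` {u'}" by (rule step.IH[OF uy _ u'(2)])
    moreover have "(u', w') \<in> D"
      by (rule union_of_imp[OF adjacency_union u'(3) um wm(1) u'(1) wm(2) sym[OF u(2)]])
    ultimately have uw': "(w', u) \<in> D" using sym by blast
    obtain a b where ab: "a \<in> fib y" "b \<in> fib z" "(a, b) \<notin> D" using link(2) by blast
    show ?thesis
    proof (rule twins[OF _ u(2) uw'])
      show "w' \<in> fib w" "b \<in> fib w" "a \<in> fib u" using step.prems ab uy by (auto simp: fib_def)
      show "(b, a) \<notin> D" using ab(3) sym by blast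
    qed
  qed
qed

lemma separable_closure:
  assumes clos: "is_coherent_closure \<Omega> {D, {(\<alpha>, \<alpha>)}} S"
  shows "separable TYPE('b) \<Omega> S"
  unfolding separable_def
proof (intro conjI allI impI)
  show "coherent_configuration \<Omega> S" by (rule coherent_configuration_axioms)
  fix \<Omega>' :: "'b set" and S' \<phi>
  assume A: "coherent_configuration \<Omega>' S' \<and> algebraic_isomorphism S S' \<phi>"
  interpret Y: coherent_configuration \<Omega>' S' using A by blast
  interpret I: algebraic_iso \<Omega> S \<Omega>' S' \<phi> by unfold_locales (use A in blast)
  \<comment> \<open>\<open>h\<close> and \<open>g\<close> only pick points in corresponding fibers,
    independently for each point. The values of \<open>h\<close> that matter are those at base
    points.\<close>
  have "\<exists>x'. x' \<in> \<Omega>' \<and> \<phi> (rel x x) = Y.rel x' x'" if x: "x \<in> \<Omega>" for x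
  proof -
    obtain x' y' where *: "x' \<in> \<Omega>'" "y' \<in> \<Omega>'" "\<phi> (rel x x) = Y.rel x' y'"
      by (rule Y.blockE[OF I.iso_mem[OF rel_mem[OF x x]]])
    then have "x' = y'" by (rule I.iso_diag[OF x])
    then show ?thesis using * by blast
  qed
  then obtain h where h: "\<And>x. x \<in> \<Omega> \<Longrightarrow> h x \<in> \<Omega>'" "\<And>x. x \<in> \<Omega> \<Longrightarrow> \<phi> (rel x x) = Y.rel (h x) (h x)"
    by metis
  have "\<exists>y. y \<in> \<Omega> \<and> \<phi> (rel y y) = Y.rel z z" if z: "z \<in> \<Omega>'" for z
  proof -
    obtain x y where *: "x \<in> \<Omega>" "y \<in> \<Omega>" "\<phi> (rel x y) = Y.rel z z"
      by (rule I.iso_surjE[OF z z])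
    have "x = y" by (rule I.iso_diag'[OF *(1,2) z *(3)])
    then show ?thesis using * by blast
  qed
  then obtain g where g: "\<And>z. z \<in> \<Omega>' \<Longrightarrow> g z \<in> \<Omega>" "\<And>z. z \<in> \<Omega>' \<Longrightarrow> \<phi> (rel (g z) (g z)) = Y.rel z z"
    by metis
  define k where "k y = rel (base y) y" for y
  \<comment> \<open>Pulling the relation back by \<open>\<phi>\<close> gives \<open>k\<close> and
    \<open>l\<close> values in the same set, so that \<open>f\<close> can be found by comparing the
    sizes of their level sets.\<close>
  define l where "l z = inv_into S \<phi> (Y.rel (h (base (g z))) z)" for z
  have fibI: "z \<in> fib y" if "y \<in> \<Omega>" "z \<in> \<Omega>" "\<phi> (rel y y) = \<phi> (rel z z)" for y z
    using I.iso_inj[OF rel_mem[OF that(1,1)] rel_mem[OF that(2,2)] that(3)] that(2) by (simp add: fib_def)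
  have l: "l z \<in> S" "\<phi> (l z) = Y.rel (h (base (g z))) z" if z: "z \<in> \<Omega>'" for z
  proof -
    have "Y.rel (h (base (g z))) z \<in> \<phi> ` S"
      using bij_betw_imp_surj_on[OF I.bij] Y.rel_mem[OF h(1)[OF base_mem[OF g(1)[OF z]]] z] by simp
    then show "l z \<in> S" "\<phi> (l z) = Y.rel (h (base (g z))) z"
      unfolding l_def by (rule inv_into_into, rule f_inv_into_f)
  qed
  \<comment> \<open>A relation determines the fiber of its target and thereby the base point, so a
    level set of \<open>k\<close> is the out-neighbourhood of a single base point in one basis
    relation; its size is a valency.\<close>
  have k_iff: "k w = k y \<longleftrightarrow> rel (base y) w = rel (base y) y" if y: "y \<in> \<Omega>" and w: "w \<in> \<Omega>" for w y
  proof
    assume eq: "k w = k y"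
    have "rel w w = rel y y"
      by (rule rel_target[OF eq[unfolded k_def] base_mem[OF w] w base_mem[OF y] y])
    then have "w \<in> fib y" using w by (simp add: fib_def)
    then show "rel (base y) w = rel (base y) y" using eq base_fib[OF y] by (simp add: k_def)
  next
    assume eq: "rel (base y) w = rel (base y) y"
    have "rel w w = rel y y" by (rule rel_target[OF eq base_mem[OF y] w base_mem[OF y] y])
    then have "w \<in> fib y" using w by (simp add: fib_def)
    then show "k w = k y" using eq base_fib[OF y] by (simp add: k_def)
  qed
  have l_iff: "l z = k y \<longleftrightarrow> Y.rel (h (base y)) z = \<phi> (rel (base y) y)"
    if y: "y \<in> \<Omega>" and z: "z \<in> \<Omega>'" for y z
  proof -
    have same: "base (g z) = base y" if "x \<in> \<Omega>'" "Y.rel x z = \<phi> (rel b y)" "b \<in> \<Omega>" for x b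
    proof -
      have "\<phi> (rel y y) = Y.rel z z"
        by (rule I.iso_target[OF that(3) y that(1) z that(2)[symmetric]])
      then have "g z \<in> fib y" using fibI[OF y g(1)[OF z]] g(2)[OF z] by simp
      then show ?thesis by (rule base_fib[OF y])
    qed
    have bm: "h (base y) \<in> \<Omega>'" "h (base (g z)) \<in> \<Omega>'" using h(1) base_mem y g(1)[OF z] by blast+
    show ?thesis
    proof
      assume "l z = k y"
      then have eq: "Y.rel (h (base (g z))) z = \<phi> (rel (base y) y)" using l(2)[OF z] by (simp add: k_def)
      then show "Y.rel (h (base y)) z = \<phi> (rel (base y) y)"
        using same[OF bm(2) eq base_mem[OF y]] by simp
    next
      assume eq: "Y.rel (h (base y)) z = \<phi> (rel (base y) y)"
      then have "\<phi> (l z) = \<phi> (k y)" using l(2)[OF z] same[OF bm(1) eq base_mem[OF y]] by (simp add: k_def)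
      then show "l z = k y" by (rule I.iso_inj[OF l(1)[OF z] rel_mem[OF base_mem[OF y] y, folded k_def]])
    qed
  qed
  have card_eq: "card {y \<in> \<Omega>. k y = k w} = card {z \<in> \<Omega>'. l z = k w}" if w: "w \<in> \<Omega>" for w
  proof -
    have "{y \<in> \<Omega>. k y = k w} = {y \<in> \<Omega>. rel (base w) y = rel (base w) w}"
      using k_iff[OF w] by blast
    moreover have "{z \<in> \<Omega>'. l z = k w} = {z \<in> \<Omega>'. Y.rel (h (base w)) z = \<phi> (rel (base w) w)}"
      using l_iff[OF w] by blast
    ultimately show ?thesis
      using I.iso_valency[OF base_mem[OF w] w h(1)[OF base_mem[OF w]] h(2)[OF base_mem[OF w]]] by simp
  qed
  have l_range: "\<exists>w\<in>\<Omega>. l z = k w" if z: "z \<in> \<Omega>'" for z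
  proof -
    define x where "x = base (g z)"
    have gz: "g z \<in> \<Omega>" by (rule g(1)[OF z])
    have x: "x \<in> \<Omega>" unfolding x_def by (rule base_mem[OF gz])
    obtain p q where pq: "p \<in> \<Omega>" "q \<in> \<Omega>" "l z = rel p q" by (rule blockE[OF l(1)[OF z]])
    have eq: "\<phi> (rel p q) = Y.rel (h x) z" using l(2)[OF z] pq(3) by (simp add: x_def)
    have "\<phi> (rel p p) = Y.rel (h x) (h x)" by (rule I.iso_source[OF pq(1,2) h(1)[OF x] z eq])
    then have "\<phi> (rel p p) = \<phi> (rel x x)" using h(2)[OF x] by simp
    then have "rel p p = rel x x" by (rule I.iso_inj[OF rel_mem[OF pq(1,1)] rel_mem[OF x x]])
    then obtain w where w: "w \<in> \<Omega>" "rel p q = rel x w" by (rule triangle[OF _ pq(1,1) x x pq(2)])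
    have "\<phi> (rel w w) = Y.rel z z"
      by (rule I.iso_target[OF x w(1) h(1)[OF x] z]) (use eq w(2) in simp)
    then have "w \<in> fib (g z)" using fibI[OF gz w(1)] g(2)[OF z] by simp
    then have "base w = x" unfolding x_def by (rule base_fib[OF gz])
    then show ?thesis using w pq(3) by (auto simp: k_def)
  qed
  have "card {y \<in> \<Omega>. k y = c} = card {z \<in> \<Omega>'. l z = c}" for c
  proof (cases "\<exists>w\<in>\<Omega>. c = k w")
    case True
    then show ?thesis using card_eq by blast
  next
    case False
    then have "{y \<in> \<Omega>. k y = c} = {}" "{z \<in> \<Omega>'. l z = c} = {}" using l_range by blast+
    then show ?thesis by (simp only: card.empty)
  qed
  then obtain f where f: "bij_betw f \<Omega> \<Omega>'" and lf: "\<forall>y\<in>\<Omega>. l (f y) = k y"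
    by (rule bij_betw_fibrewise[OF finite_points Y.finite_points])
  have fm: "f y \<in> \<Omega>'" if "y \<in> \<Omega>" for y using f that bij_betwE by blast
  have f_base: "\<phi> (rel (base y) y) = Y.rel (h (base y)) (f y)" if y: "y \<in> \<Omega>" for y
    using l_iff[OF y fm[OF y]] lf y by simp
  have f_fib: "\<phi> (rel y y) = Y.rel (f y) (f y)" if y: "y \<in> \<Omega>" for y
    by (rule I.iso_target[OF base_mem[OF y] y h(1)[OF base_mem[OF y]] fm[OF y] f_base[OF y]])
  have agree: "(x, y) \<in> t \<longleftrightarrow> (u, v) \<in> t"
    if t: "t \<in> {D, {(\<alpha>, \<alpha>)}}" and m: "x \<in> \<Omega>" "y \<in> \<Omega>" "u \<in> \<Omega>" "v \<in> \<Omega>"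
      and eq: "\<phi> (rel u v) = Y.rel (f x) (f y)" for t x y u v
  proof -
    have ux: "u \<in> fib x"
      using fibI[OF m(1,3)] f_fib[OF m(1)] I.iso_source[OF m(3,4) fm[OF m(1)] fm[OF m(2)] eq] by simp
    have vy: "v \<in> fib y"
      using fibI[OF m(2,4)] f_fib[OF m(2)] I.iso_target[OF m(3,4) fm[OF m(1)] fm[OF m(2)] eq] by simp
    have "(x, y) \<in> D \<longleftrightarrow> (u, v) \<in> D"
    proof (cases "(fib x \<times> fib y) \<inter> D \<noteq> {} \<and> \<not> fib x \<times> fib y \<subseteq> D")
      case True
      then have "(x, y) \<in> linked" using m unfolding linked_def by blast
      then have bxy: "base x = base y" by (intro base_eq) blast
      define c where "c = base y"
      have c: "c \<in> \<Omega>" unfolding c_def by (rule base_mem[OF m(2)])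
      have cy: "\<phi> (rel c y) = Y.rel (h c) (f y)" using f_base[OF m(2)] by (simp add: c_def)
      have cx: "\<phi> (rel c x) = Y.rel (h c) (f x)" using f_base[OF m(1)] bxy by (simp add: c_def)
      \<comment> \<open>The triangle \<open>h c\<close>, \<open>f x\<close>, \<open>f y\<close> is
        pulled back over \<open>(c, y)\<close>. Its third point \<open>w\<close> need not be
        \<open>x\<close>, but it has the same relation from the base point and is thus a twin of
        \<open>x\<close>, which suffices for adjacency.\<close>
      have "\<exists>w\<in>\<Omega>. rel c w = rel c x \<and> rel w y = rel u v"
        unfolding I.iso_triangle_iff[OF rel_mem[OF c m(1)] rel_mem[OF m(3,4)] c m(2) h(1)[OF c] fm[OF m(2)] cy]
        using cx eq fm[OF m(1)] by auto
      then obtain w where w: "w \<in> \<Omega>" "rel c w = rel c x" "rel w y = rel u v" by blast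
      have "rel w w = rel x x" by (rule rel_target[OF w(2) c w(1) c m(1)])
      then have "w \<in> fib x" using w(1) by (simp add: fib_def)
      moreover have "(c, x) \<in> linked\<^sup>*" using linked_base[of x] bxy by (simp add: c_def)
      ultimately have "D `` {w} = D `` {x}"
        using linked_determines_twins[OF c _ _ _ w(2)] m(1) by simp
      moreover have "(w, y) \<in> D \<longleftrightarrow> (u, v) \<in> D"
        by (rule union_of_rel[OF adjacency_union w(3) w(1) m(2,3,4)])
      ultimately show ?thesis by blast
    next
      \<comment> \<open>Adjacency between these two fibers is all or nothing, so knowing the fibers
        of \<open>u\<close> and \<open>v\<close> is enough.\<close>
      case False
      moreover have "(x, y) \<in> fib x \<times> fib y" "(u, v) \<in> fib x \<times> fib y" using m ux vy by auto
      ultimately show ?thesis by blast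
    qed
    moreover have "(x, y) \<in> {(\<alpha>, \<alpha>)} \<longleftrightarrow> (u, v) \<in> {(\<alpha>, \<alpha>)}"
      using fib_root[of u] fib_root[of v] fib_root[of x] fib_root[of y] ux vy
        fib_sym[OF ux m(1)] fib_sym[OF vy m(2)] by auto
    ultimately show ?thesis using t by blast
  qed
  have "\<phi> (rel x y) = Y.rel (f x) (f y)" if "x \<in> \<Omega>" "y \<in> \<Omega>" for x y
    by (rule I.induced_by_bijection[OF clos f agree that])
  then show "\<exists>f. combinatorial_isomorphism \<Omega> S \<Omega>' S' f \<and> (\<forall>s\<in>S. \<phi> s = map_prod f f ` s)"
    using I.isomorphism_of_bijection[OF f] by blast
qed

end

section \<open>From the graph hypotheses to the rooted setting\<close>

lemma long_cycle_free_chordal_bipartite: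
  assumes "pair_graph X" "chordal_bipartite X"
  obtains col where "long_cycle_free (parcs X) col"
proof -
  interpret pair_graph X by fact
  obtain U V where UV: "pverts X = U \<union> V" "U \<inter> V = {}" "parcs X \<subseteq> U \<times> V \<union> V \<times> U"
    using assms(2) unfolding chordal_bipartite_def bipartite_def by blast
  have "long_cycle_free (parcs X) (\<lambda>x. x \<in> U)"
  proof
    show "(y, x) \<in> parcs X" if "(x, y) \<in> parcs X" for x y using arcs_symmetric[OF that] .
    show "(x \<in> U) \<noteq> (y \<in> U)" if "(x, y) \<in> parcs X" for x y using that UV by blast
    fix n :: nat and f :: "nat \<Rightarrow> 'a"
    assume n: "n \<ge> 6" and inj: "inj_on f {..<n}"
    show "\<exists>i<n. \<exists>j<n. ((f i, f j) \<in> parcs X) \<noteq> (j = Suc i mod n \<or> i = Suc j mod n)"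
    proof (rule ccontr)
      assume "\<not> ?thesis"
      then have adj: "(f i, f j) \<in> parcs X \<longleftrightarrow> (j = Suc i mod n \<or> i = Suc j mod n)" if "i < n" "j < n" for i j
        using that by blast
      have "f i \<in> pverts X" if "i < n" for i
        using adj[OF that, of "Suc i mod n"] n in_arcsD1 by auto
      moreover have "n \<ge> 2" using n by simp
      ultimately have "contains_induced X (cycle_graph n)"
        unfolding contains_induced_iff[OF assms(1) pair_graph_cycle_graph[OF \<open>n \<ge> 2\<close>]]
        using adj inj by (intro exI[of _ f]) (auto simp: cycle_graph_def)
      then show False using assms(2) n unfolding chordal_bipartite_def by blast
    qed
  qed
  then show thesis by (rule that)
qed

lemma T2_free_no_bipartite_claw:
  assumes X: "pair_graph X" "T2_free X" and "long_cycle_free (parcs X) col"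
    and "(c, m1) \<in> parcs X" "(c, m2) \<in> parcs X" "(c, m3) \<in> parcs X"
    and "(m1, l1) \<in> parcs X" "(m2, l2) \<in> parcs X" "(m3, l3) \<in> parcs X"
    and "(m1, l2) \<notin> parcs X" "(m1, l3) \<notin> parcs X" "(m2, l1) \<notin> parcs X"
    and "(m2, l3) \<notin> parcs X" "(m3, l1) \<notin> parcs X" "(m3, l2) \<notin> parcs X"
  shows False
proof -
  interpret pair_graph X by fact
  interpret long_cycle_free "parcs X" col by fact
  note edges = assms(4-9) and nonedges = assms(10-15)
  note sy = edges[THEN sym]
  note co = edges[THEN col]
  have nsy: "(y, x) \<notin> parcs X" if "(x, y) \<notin> parcs X" for x y using that sym by blast
  \<comment> \<open>The order follows the numbering of \<open>bipartite_claw\<close>: centre 0,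
    leaves 1 to 3, subdividing vertices 4 to 6.\<close>
  define f where "f = (!) [c, l1, l2, l3, m1, m2, m3]"
  have f: "f 0 = c" "f 1 = l1" "f (Suc 0) = l1" "f 2 = l2" "f 3 = l3" "f 4 = m1" "f 5 = m2" "f 6 = m3"
    by (simp_all add: f_def eval_nat_numeral)
  have dist: "c \<noteq> l1" "c \<noteq> l2" "c \<noteq> l3" "l1 \<noteq> l2" "l1 \<noteq> l3" "l2 \<noteq> l3" "m1 \<noteq> m2" "m1 \<noteq> m3" "m2 \<noteq> m3"
    using edges nonedges sy by metis+
  have colour: "col l1 = col c" "col l2 = col c" "col l3 = col c"
    "col m1 \<noteq> col c" "col m2 \<noteq> col c" "col m3 \<noteq> col c"
    using co by auto
  have mem: "{c, l1, l2, l3, m1, m2, m3} \<subseteq> pverts X" using edges in_arcsD1 in_arcsD2 by auto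
  have same: "(x, y) \<notin> parcs X" if "col x = col y" for x y using that col by blast
  have "contains_induced X bipartite_claw"
    unfolding contains_induced_iff[OF X(1) pair_graph_bipartite_claw]
  proof (intro exI[of _ f] conjI)
    show "inj_on f (pverts bipartite_claw)"
      unfolding bipartite_claw_simps inj_on_def using dist colour by (auto simp: f)
    show "f ` pverts bipartite_claw \<subseteq> pverts X"
      using mem by (simp add: bipartite_claw_simps f)
    show "\<forall>u\<in>pverts bipartite_claw. \<forall>v\<in>pverts bipartite_claw.
        ((f u, f v) \<in> parcs X) = ((u, v) \<in> parcs bipartite_claw)"
      unfolding bipartite_claw_simps
      using edges sy nonedges nonedges[THEN nsy] colour by (simp add: f same)
  qed
  then show False using X(2) unfolding T2_free_def by blast
qed

theorem theorem1p2:
  fixes X :: "'a pair_pre_digraph" and \<alpha> :: 'a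
  assumes "pair_graph X"
    and "connected (with_proj X)"
    and "chordal_bipartite X"
    and "T2_free X"
    and "\<alpha> \<in> pverts X"
  shows "separable TYPE('b) (pverts X) (WL_point X \<alpha>)"
proof -
  interpret pair_graph X by fact
  obtain col where free: "long_cycle_free (parcs X) col"
    by (rule long_cycle_free_chordal_bipartite[OF assms(1,3)])
  have clos: "is_coherent_closure (pverts X) {parcs X, {(\<alpha>, \<alpha>)}} (WL_point X \<alpha>)"
    by (rule is_coherent_closure_WL_point[OF assms(1,5)])
  interpret coherent_configuration "pverts X" "WL_point X \<alpha>"
    using clos unfolding is_coherent_closure_def by blast
  interpret long_cycle_free "parcs X" col by fact
  interpret rooted_graph "pverts X" "WL_point X \<alpha>" "parcs X" col \<alpha>
  proof
    show "union_of (WL_point X \<alpha>) (parcs X)" "union_of (WL_point X \<alpha>) {(\<alpha>, \<alpha>)}"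
      using clos unfolding is_coherent_closure_def by blast+
    show "\<alpha> \<in> pverts X" by fact
    show "(\<alpha>, x) \<in> (parcs X)\<^sup>*" if "x \<in> pverts X" for x
    proof -
      \<comment> \<open>\<open>connected\<close> refers to the symmetrised digraph; since the arcs
        are already symmetric, reachability there is reachability in \<open>X\<close>.\<close>
      have "\<alpha> \<rightarrow>\<^sup>*\<^bsub>with_proj (mk_symmetric (with_proj X))\<^esub> x"
        using assms(2,5) that unfolding connected_def strongly_connected_def by simp
      then have "\<alpha> \<rightarrow>\<^sup>*\<^bsub>with_proj X\<^esub> x"
        using reachable_mk_symmetric_eq[OF sym_arcs] by simp
      then have "(\<alpha>, x) \<in> (arcs_ends (with_proj X))\<^sup>*" by (rule reachable_rtranclI)
      moreover have "arcs_ends (with_proj X) = parcs X" by (simp add: arcs_ends_conv)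
      ultimately show ?thesis by simp
    qed
  qed (rule T2_free_no_bipartite_claw[OF assms(1,4) free])
  show ?thesis by (rule separable_closure[OF clos])
qed

end
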